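(* Let $\lambda/\mu$ be a connected r-shape, let $\mathbf a,\mathbf b$ be column flags for $\lambda/\mu$, and let $\Theta=(\theta_1,\ldots,\theta_k)$ be an outer ribbon decomposition of $\lambda/\mu$. For each $i,j\in[k]$ let $\mathbf a^{ij},\mathbf b^{ij}$ be the induced ribbon flags of $\theta_i\#\theta_j$. Then $$\mathsf S^{\mathbf a,\mathbf b}_{\lambda/\mu}(\mathbf y/\mathbf z)=\det\left[\mathsf S^{\mathbf a^{ij},\mathbf b^{ij}}_{\theta_i\#\theta_j}(\mathbf y/\mathbf z)\right]_{1\le i,j\le k},$$ where by convention the entry equals $1$ if $\theta_i\#\theta_j=\varnothing$ and equals $0$ if $\theta_i\#\theta_j$ is undefined.
   Context: Young diagrams are in English notation; a cell $(i,j)$ lies in row $i$ and column $j$, and $\mathrm{row}(\gamma),\mathrm{col}(\gamma)$ denote the row and column of a cell $\gamma$. $\lambda'$ is the conjugate partition. For partitions $\mu\subseteq\lambda$, $\lambda/\mu$ is the skew diagram $[\lambda]\setminus[\mu]$. An r-shape is a pair $(\lambda/\mu,r)$, $r\in\mathbb Z$, whose cells carry shifted contents $c(i,j)=j-i+r-1+\lambda'_1$ (so the bottom-left cell has content $r$, the "root content"). It is connected if its diagram is edgewise connected. Column flags for an r-shape $\lambda/\mu$: for $n\ge\lambda_1$, vectors $\mathbf a=(a_i),\mathbf b=(b_i)\in\mathbb Z^n$ with $a_i-a_{i+1}\le\mu'_i-\mu'_{i+1}+1$ and $b_i-b_{i+1}\le\lambda'_i-\lambda'_{i+1}+1$ for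 every $i$ with $\mu'_i<\lambda'_{i+1}$. Their conjugate flags are $a'_i=a_i+c(\gamma_i)$, $b'_i=b_i+c(\delta_i)$, where $\gamma_i,\delta_i$ are the top and bottom cells of column $i$ (shifted contents). Variables $\mathbf y=(y_i)_{i\in\mathbb Z}$, $\mathbf z=(z_i)_{i\in\mathbb Z}$; $\mathbf y_{a,b}=(y_a,\ldots,y_b)$, empty if $a>b$. For variable sets $\mathbf x,\mathbf w$: $e_n(\mathbf x/\mathbf w)=\sum_{i=0}^n(-1)^{n-i}e_i(\mathbf x)h_{n-i}(\mathbf w)$, where $e_i,h_i$ are the elementary and complete homogeneous symmetric functions ($e_0=h_0=1$, and $e_n=0$ for $n<0$). The flagged supersymmetric Schur function is $\mathsf S^{\mathbf a,\mathbf b}_{\lambda/\mu}(\mathbf y/\mathbf z)=\det[e_{\lambda'_i-i-\mu'_j+j}(\mathbf y_{a_j,b_i}/\mathbf z_{a'_j,b'_i})]_{1\le i,j\le n}$. Ribbons: a ribbon is an edgewise connected skew diagram with no $2\times2$ block; its head is its bottom-left cell and its tail its top-right cell. A cell of $\lambda/\mu$ is on the top (right, bottom, left) perimeter if the cell directly above (right, below, left) is not in $\lambda/\mu$. An outer ribbon decomposition $\Theta=(\theta_1,\ldots,\theta_k)$ of $\lambda/\mu$ is a partition of its cells into ribbons such that each head lies on the left or bottom perimeter and each tail on the top or right perimeter. A cell $\gamma\in\theta_i$ goes up if the cell directly above $\gamma$ is in $\theta_i$, or $\gamma$ is the tail of $\theta_i$ and lies on the top perimeter; it goes right if the cell directly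 to its right is in $\theta_i$, or $\gamma$ is the tail of $\theta_i$ and lies on the right perimeter; the top-right cell of $\lambda/\mu$, lying in $\theta_i$, goes up if the cell directly below it is in $\theta_i$ and goes right if the cell directly to its left is in $\theta_i$. All cells of $\lambda/\mu$ with a given content go in the same direction. The cutting strip $\Theta(\lambda/\mu)$ is the ribbon whose cells have exactly the contents occurring in $\lambda/\mu$, the cell of content $c+1$ lying directly above (resp. directly right of) the cell of content $c$ when the cells of content $c$ in $\lambda/\mu$ go up (resp. right). For integers $p\le q$, $\Theta(p,q)$ is the sub-ribbon of the cutting strip consisting of cells with contents in $[p,q]$, regarded as an r-shape with root content $p$; $\Theta(p,q)=\varnothing$ if $p=q+1$, and $\Theta(p,q)$ is undefined if $p>q+1$. Define $\theta_i\#\theta_j=\Theta(c(\delta_i),c(\gamma_j))$, where $\delta_i$ is the head of $\theta_i$ and $\gamma_j$ the tail of $\theta_j$. Canonical decomposition: a ribbon $\theta$ is written $\theta=\rho_1\to\cdots\to\rho_K$, where $\rho_1,\ldots,\rho_K$ are vertical strips (its maximal column segments, from left to right) and $D_1\to D_2$ means placing the bottom-left cell of $D_2$ directly to the right of the top-right cell of $D_1$. Induced ribbon flags: if $\theta_i\#\theta_j=\rho_1\to\cdots\to\rho_K$ is nonempty and defined, let $\delta_r,\gamma_r$ be the bottom and top cells of $\rho_r$, let $M_r$ be the rightmost cell of $\lambda/\mu$ with content $c(\delta_r)$ and $m_r$ the leftmost cell of $\lambda/\mu$ with content $c(\gamma_r)$ (rows and columns measured in $\lambda/\mu$). Then $a^{ij}_r=a_{\mathrm{col}(m_r)}-(\mu'_{\mathrm{col}(m_r)}+1)+\mathrm{row}(m_r)$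 and $b^{ij}_r=b_{\mathrm{col}(M_r)}-\lambda'_{\mathrm{col}(M_r)}+\mathrm{row}(M_r)$, $r\in[K]$; these serve as column flags of the r-shape $\theta_i\#\theta_j$ (whose conjugate flags are computed with its shifted contents). *)

theory Defs
  imports "Jordan_Normal_Form.Determinant"
begin

section \<open>Partitions, diagrams, shifted contents\<close>

type_synonym cell = "int \<times> int"  (* (row, column), English notation, 1-based *)

definition is_partition :: "nat list \<Rightarrow> bool" where
  "is_partition lam \<longleftrightarrow> sorted_wrt (\<ge>) lam"

(* lam_i, zero outside 1..length *)
definition part :: "nat list \<Rightarrow> int \<Rightarrow> int" where
  "part lam i = (if 1 \<le> i \<and> i \<le> int (length lam) then int (lam ! nat (i - 1)) else 0)"

(* conjugate partition lam'_j (for j \<ge> 1) *)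
definition conjp :: "nat list \<Rightarrow> int \<Rightarrow> int" where
  "conjp lam j = int (length (filter (\<lambda>x. j \<le> int x) lam))"

definition contained :: "nat list \<Rightarrow> nat list \<Rightarrow> bool" where
  "contained mu lam \<longleftrightarrow> (\<forall>i. part mu i \<le> part lam i)"

definition diagram :: "nat list \<Rightarrow> cell set" where
  "diagram lam = {(i, j). 1 \<le> i \<and> 1 \<le> j \<and> j \<le> part lam i}"

definition skew :: "nat list \<Rightarrow> nat list \<Rightarrow> cell set" where
  "skew lam mu = diagram lam - diagram mu"

(* shifted content c(i,j) = j - i + r - 1 + lam'_1 of the r-shape (lam/mu, r) *)
definition scontent :: "nat list \<Rightarrow> int \<Rightarrow> cell \<Rightarrow> int" where
  "scontent lam r c = snd c - fst c + r - 1 + conjp lam 1"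

definition adjacent :: "cell \<Rightarrow> cell \<Rightarrow> bool" where
  "adjacent c d \<longleftrightarrow> \<bar>fst c - fst d\<bar> + \<bar>snd c - snd d\<bar> = 1"

definition edge_connected :: "cell set \<Rightarrow> bool" where
  "edge_connected D \<longleftrightarrow>
     (\<forall>x\<in>D. \<forall>y\<in>D. (x, y) \<in> {(u, v). u \<in> D \<and> v \<in> D \<and> adjacent u v}\<^sup>*)"

section \<open>Column flags and flagged supersymmetric Schur functions\<close>

definition column_flags :: "nat \<Rightarrow> nat list \<Rightarrow> nat list \<Rightarrow> (int \<Rightarrow> int) \<Rightarrow> (int \<Rightarrow> int) \<Rightarrow> bool" where
  "column_flags n lam mu a b \<longleftrightarrow> part lam 1 \<le> int n \<and>
     (\<forall>i. 1 \<le> i \<and> i < int n \<and> conjp mu i < conjp lam (i + 1) \<longrightarrow>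
        a i - a (i + 1) \<le> conjp mu i - conjp mu (i + 1) + 1 \<and>
        b i - b (i + 1) \<le> conjp lam i - conjp lam (i + 1) + 1)"

(* conjugate flags: a'_i = a_i + c(top cell of column i), b'_i = b_i + c(bottom cell of column i) *)
definition conj_flag_a :: "nat list \<Rightarrow> nat list \<Rightarrow> int \<Rightarrow> (int \<Rightarrow> int) \<Rightarrow> int \<Rightarrow> int" where
  "conj_flag_a lam mu r a i = a i + scontent lam r (conjp mu i + 1, i)"

definition conj_flag_b :: "nat list \<Rightarrow> int \<Rightarrow> (int \<Rightarrow> int) \<Rightarrow> int \<Rightarrow> int" where
  "conj_flag_b lam r b i = b i + scontent lam r (conjp lam i, i)"

(* y_{p,q} = (y_p, ..., y_q), empty if p > q *)
definition vars :: "(int \<Rightarrow> 'a) \<Rightarrow> int \<Rightarrow> int \<Rightarrow> 'a list" where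
  "vars y p q = map y [p..q]"

fun esym :: "'a::comm_ring_1 list \<Rightarrow> nat \<Rightarrow> 'a" where
  "esym [] m = (if m = 0 then 1 else 0)"
| "esym (x # xs) 0 = 1"
| "esym (x # xs) (Suc m) = esym xs (Suc m) + x * esym xs m"

fun hsym :: "'a::comm_ring_1 list \<Rightarrow> nat \<Rightarrow> 'a" where
  "hsym [] m = (if m = 0 then 1 else 0)"
| "hsym (x # xs) m = (\<Sum>j\<le>m. x ^ j * hsym xs (m - j))"

(* e_n(x / w) = sum_{i=0}^n (-1)^(n-i) e_i(x) h_{n-i}(w), and 0 for n < 0 *)
definition esuper :: "int \<Rightarrow> 'a::comm_ring_1 list \<Rightarrow> 'a list \<Rightarrow> 'a" where
  "esuper n xs ws = (if n < 0 then 0 else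
     (\<Sum>i\<le>nat n. (-1) ^ (nat n - i) * esym xs i * hsym ws (nat n - i)))"

(* S^{a,b}_{lam/mu}(y/z) of the r-shape (lam/mu, r), computed with n columns *)
definition flagged_schur ::
  "nat \<Rightarrow> nat list \<Rightarrow> nat list \<Rightarrow> int \<Rightarrow> (int \<Rightarrow> int) \<Rightarrow> (int \<Rightarrow> int)
    \<Rightarrow> (int \<Rightarrow> 'a::comm_ring_1) \<Rightarrow> (int \<Rightarrow> 'a) \<Rightarrow> 'a" where
  "flagged_schur n lam mu r a b y z = det (mat n n (\<lambda>(i0, j0).
      let i = int i0 + 1; j = int j0 + 1 in
      esuper (conjp lam i - i - conjp mu j + j)
        (vars y (a j) (b i))
        (vars z (conj_flag_a lam mu r a j) (conj_flag_b lam r b i))))"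

section \<open>Ribbons and outer ribbon decompositions\<close>

definition is_skew_diagram :: "cell set \<Rightarrow> bool" where
  "is_skew_diagram S \<longleftrightarrow> (\<exists>lam mu. is_partition lam \<and> is_partition mu \<and> contained mu lam
      \<and> S = skew lam mu)"

definition is_ribbon :: "cell set \<Rightarrow> bool" where
  "is_ribbon S \<longleftrightarrow> S \<noteq> {} \<and> is_skew_diagram S \<and> edge_connected S \<and>
     \<not> (\<exists>i j. (i, j) \<in> S \<and> (i + 1, j) \<in> S \<and> (i, j + 1) \<in> S \<and> (i + 1, j + 1) \<in> S)"

(* bottom-left cell: leftmost column, lowest cell in it *)
definition bottom_left :: "cell set \<Rightarrow> cell" where
  "bottom_left S = (THE c. c \<in> S \<and> (\<forall>d\<in>S. snd c \<le> snd d) \<and>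
                           (\<forall>d\<in>S. snd d = snd c \<longrightarrow> fst d \<le> fst c))"

(* top-right cell: rightmost column, highest cell in it *)
definition top_right :: "cell set \<Rightarrow> cell" where
  "top_right S = (THE c. c \<in> S \<and> (\<forall>d\<in>S. snd d \<le> snd c) \<and>
                         (\<forall>d\<in>S. snd d = snd c \<longrightarrow> fst c \<le> fst d))"

definition on_top :: "cell set \<Rightarrow> cell \<Rightarrow> bool" where
  "on_top D c \<longleftrightarrow> (fst c - 1, snd c) \<notin> D"
definition on_right :: "cell set \<Rightarrow> cell \<Rightarrow> bool" where
  "on_right D c \<longleftrightarrow> (fst c, snd c + 1) \<notin> D"
definition on_bottom :: "cell set \<Rightarrow> cell \<Rightarrow> bool" where
  "on_bottom D c \<longleftrightarrow> (fst c + 1, snd c) \<notin> D"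
definition on_left :: "cell set \<Rightarrow> cell \<Rightarrow> bool" where
  "on_left D c \<longleftrightarrow> (fst c, snd c - 1) \<notin> D"

definition outer_ribbon_decomp :: "cell set \<Rightarrow> cell set list \<Rightarrow> bool" where
  "outer_ribbon_decomp D Th \<longleftrightarrow>
     (\<forall>th \<in> set Th. is_ribbon th \<and>
        (on_left D (bottom_left th) \<or> on_bottom D (bottom_left th)) \<and>
        (on_top D (top_right th) \<or> on_right D (top_right th))) \<and>
     \<Union>(set Th) = D \<and>
     (\<forall>i < length Th. \<forall>j < length Th. i \<noteq> j \<longrightarrow> Th ! i \<inter> Th ! j = {})"

(* direction of a cell g lying in the ribbon th of a decomposition of D *)
definition goes_up :: "cell set \<Rightarrow> cell set \<Rightarrow> cell \<Rightarrow> bool" where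
  "goes_up D th g \<longleftrightarrow> (if g = top_right D then (fst g + 1, snd g) \<in> th
     else (fst g - 1, snd g) \<in> th \<or> (g = top_right th \<and> on_top D g))"

definition goes_right :: "cell set \<Rightarrow> cell set \<Rightarrow> cell \<Rightarrow> bool" where
  "goes_right D th g \<longleftrightarrow> (if g = top_right D then (fst g, snd g - 1) \<in> th
     else (fst g, snd g + 1) \<in> th \<or> (g = top_right th \<and> on_right D g))"

(* the cells of content c go up (all cells of a given content go in the same direction) *)
definition content_up :: "nat list \<Rightarrow> nat list \<Rightarrow> int \<Rightarrow> cell set list \<Rightarrow> int \<Rightarrow> bool" where
  "content_up lam mu r Th c \<longleftrightarrow>
     (\<exists>th \<in> set Th. \<exists>g \<in> th. scontent lam r g = c \<and> goes_up (skew lam mu) th g)"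

section \<open>The cutting strip and its sub-ribbons Theta(p,q)\<close>

(* relative position of the cell of content p + m, the cell of content p at (0,0) *)
primrec relpos :: "(int \<Rightarrow> bool) \<Rightarrow> int \<Rightarrow> nat \<Rightarrow> cell" where
  "relpos up p 0 = (0, 0)"
| "relpos up p (Suc m) = (if up (p + int m)
      then (fst (relpos up p m) - 1, snd (relpos up p m))
      else (fst (relpos up p m), snd (relpos up p m) + 1))"

definition strip_rows :: "(int \<Rightarrow> bool) \<Rightarrow> int \<Rightarrow> int \<Rightarrow> nat" where
  "strip_rows up p q = 1 + card {m. m < nat (q - p) \<and> up (p + int m)}"

definition strip_cols :: "(int \<Rightarrow> bool) \<Rightarrow> int \<Rightarrow> int \<Rightarrow> nat" where
  "strip_cols up p q = 1 + card {m. m < nat (q - p) \<and> \<not> up (p + int m)}"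

(* cells of Theta(p,q), placed in standard position: rows 1..R, columns 1..K *)
definition strip_cells :: "(int \<Rightarrow> bool) \<Rightarrow> int \<Rightarrow> int \<Rightarrow> cell set" where
  "strip_cells up p q = (\<lambda>m. (fst (relpos up p m) + int (strip_rows up p q), snd (relpos up p m) + 1))
      ` {..nat (q - p)}"

definition strip_lam :: "(int \<Rightarrow> bool) \<Rightarrow> int \<Rightarrow> int \<Rightarrow> nat list" where
  "strip_lam up p q = map (\<lambda>i. nat (Max {j. (int i, j) \<in> strip_cells up p q}))
      [1..<strip_rows up p q + 1]"

definition strip_mu :: "(int \<Rightarrow> bool) \<Rightarrow> int \<Rightarrow> int \<Rightarrow> nat list" where
  "strip_mu up p q = map (\<lambda>i. nat (Min {j. (int i, j) \<in> strip_cells up p q} - 1))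
      [1..<strip_rows up p q + 1]"

(* bottom and top cells of the r-th vertical strip rho_r (= column r) of Theta(p,q) *)
definition strip_col_bottom :: "(int \<Rightarrow> bool) \<Rightarrow> int \<Rightarrow> int \<Rightarrow> int \<Rightarrow> cell" where
  "strip_col_bottom up p q k = (Max {i. (i, k) \<in> strip_cells up p q}, k)"

definition strip_col_top :: "(int \<Rightarrow> bool) \<Rightarrow> int \<Rightarrow> int \<Rightarrow> int \<Rightarrow> cell" where
  "strip_col_top up p q k = (Min {i. (i, k) \<in> strip_cells up p q}, k)"

section \<open>Induced ribbon flags\<close>

definition rightmost_with_content :: "cell set \<Rightarrow> (cell \<Rightarrow> int) \<Rightarrow> int \<Rightarrow> cell" where
  "rightmost_with_content D cnt c = (THE g. g \<in> D \<and> cnt g = c \<and>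
      (\<forall>d\<in>D. cnt d = c \<longrightarrow> snd d \<le> snd g))"

definition leftmost_with_content :: "cell set \<Rightarrow> (cell \<Rightarrow> int) \<Rightarrow> int \<Rightarrow> cell" where
  "leftmost_with_content D cnt c = (THE g. g \<in> D \<and> cnt g = c \<and>
      (\<forall>d\<in>D. cnt d = c \<longrightarrow> snd g \<le> snd d))"

(* a^{ij}_k, where Theta(p,q) = theta_i # theta_j *)
definition induced_a :: "nat list \<Rightarrow> nat list \<Rightarrow> int \<Rightarrow> (int \<Rightarrow> int) \<Rightarrow> (int \<Rightarrow> bool)
    \<Rightarrow> int \<Rightarrow> int \<Rightarrow> int \<Rightarrow> int" where
  "induced_a lam mu r a up p q k =
     (let c = scontent (strip_lam up p q) p (strip_col_top up p q k);
          m = leftmost_with_content (skew lam mu) (scontent lam r) c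
      in a (snd m) - (conjp mu (snd m) + 1) + fst m)"

definition induced_b :: "nat list \<Rightarrow> nat list \<Rightarrow> int \<Rightarrow> (int \<Rightarrow> int) \<Rightarrow> (int \<Rightarrow> bool)
    \<Rightarrow> int \<Rightarrow> int \<Rightarrow> int \<Rightarrow> int" where
  "induced_b lam mu r b up p q k =
     (let c = scontent (strip_lam up p q) p (strip_col_bottom up p q k);
          M = rightmost_with_content (skew lam mu) (scontent lam r) c
      in b (snd M) - conjp lam (snd M) + fst M)"

(* the (i,j) entry S^{a^{ij},b^{ij}}_{theta_i # theta_j}(y/z), with the conventions 1 / 0 *)
definition ribbon_entry ::
  "nat list \<Rightarrow> nat list \<Rightarrow> int \<Rightarrow> (int \<Rightarrow> int) \<Rightarrow> (int \<Rightarrow> int) \<Rightarrow> cell set list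
     \<Rightarrow> (int \<Rightarrow> 'a::comm_ring_1) \<Rightarrow> (int \<Rightarrow> 'a) \<Rightarrow> nat \<Rightarrow> nat \<Rightarrow> 'a" where
  "ribbon_entry lam mu r a b Th y z i j =
     (let up = content_up lam mu r Th;
          p = scontent lam r (bottom_left (Th ! i));
          q = scontent lam r (top_right (Th ! j))
      in if p = q + 1 then 1
         else if p > q + 1 then 0
         else flagged_schur (strip_cols up p q) (strip_lam up p q) (strip_mu up p q) p
                (induced_a lam mu r a up p q) (induced_b lam mu r b up p q) y z)"

end

theory Submission
  imports Defs
begin

text \<open>The flags enter a determinant only through the one-column entries \<open>E d g\<close>, where \<open>d\<close> and \<open>g\<close> are the
  contents of the bottom and the top cell of a column: both sides use the same two-variable function \<open>E\<close>.
  For a set \<open>G\<close> of contents (those whose cells go right), cut the diagram into the ribbons that \<open>G\<close>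
  prescribes, and consider the square matrix indexed by all cells of the diagram whose row \<open>x\<close> is
  \<open>-1\<close> at the predecessor of \<open>x\<close> in its ribbon, or, if \<open>x\<close> is a head, has the ribbon
  Schur functions of the segments from \<open>x\<close> to the tails. Contracting the ribbons turns its determinant into
  the ribbon determinant of the decomposition, with the correct sign. For \<open>G = {}\<close> the ribbons are the columns, which
  gives the Jacobi-Trudi determinant. Adding one content \<open>c\<close> to \<open>G\<close> does not change the determinant:
  as \<open>R' p q = R p c * R (c + 1) q - R p q\<close> for the segments that pass \<open>c\<close>, a row (or column) operation,
  a sign change and a signed cyclic shift of one diagonal lead from one matrix to the other.\<close>

section \<open>Determinants indexed by finite sets\<close>

text \<open>Cells rather than ribbons serve as indices because switching one content can create or
  destroy a ribbon: the ribbon determinants before and after may differ in size, while the cell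
  matrix keeps its size. What happens depends on the rows occupied by two neighbouring diagonals.
  Convexity and connectedness make these rows intervals whose ends differ by at most one, hence four
  cases: diagonal \<open>c + 1\<close> is shifted up by one against diagonal \<open>c\<close>,
  occupies the same rows, is one longer, or is one shorter. In the first two cases one cutting
  matches the diagonals completely and the other leaves an extra head and an extra tail; in the last
  two each cutting leaves one head, respectively one tail, at opposite ends of the longer diagonal.
  The cycles that carry this end across the diagonal are signed so as to have determinant 1, and the
  entries \<open>-1\<close> are chosen so that contracting a ribbon costs no sign. Index sets are
  arbitrary finite sets because cells, columns and ribbons all occur as indices.\<close>

definition fdet :: "'i set \<Rightarrow> ('i \<Rightarrow> 'i \<Rightarrow> 'a::comm_ring_1) \<Rightarrow> 'a" where
  "fdet A f = (\<Sum>p | p permutes A. of_int (sign p) * (\<Prod>x\<in>A. f x (p x)))"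

lemma fdet_cong:
  assumes "\<And>x y. x \<in> A \<Longrightarrow> y \<in> A \<Longrightarrow> f x y = g x y"
  shows "fdet A f = fdet A g"
  unfolding fdet_def
  by (intro sum.cong refl arg_cong2[where f = "(*)"] prod.cong)
     (auto simp: assms permutes_in_image)

text \<open>Rows and columns are renamed together, so each permutation is merely conjugated and
  keeps its sign; no order on the indices is involved.\<close>

lemma fdet_reindex:
  assumes h: "bij_betw h B A" and B: "finite B"
  shows "fdet A f = fdet B (\<lambda>i j. f (h i) (h j))"
proof -
  have inj: "inj_on h B" and img: "h ` B = A"
    using h by (auto simp: bij_betw_def)
  define g where "g = inv_into B h"
  have g: "bij_betw g A B" unfolding g_def by (rule bij_betw_inv_into[OF h])
  have gh: "g (h x) = x" if "x \<in> B" for x using inj that by (simp add: g_def)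
  have hg: "h (g x) = x" if "x \<in> A" for x
    using img that by (auto simp: g_def f_inv_into_f)
  show ?thesis
    unfolding fdet_def
  proof (rule sum.reindex_bij_witness[where i = "map_permutation B h" and j = "map_permutation A g"])
    fix p assume "p \<in> {p. p permutes A}"
    then have p: "p permutes A" by simp
    show "map_permutation B h (map_permutation A g p) = p"
      by (rule map_permutation_compose_inv[OF g p]) (use hg in auto)
    show "map_permutation A g p \<in> {p. p permutes B}"
      using map_permutation_permutes[OF g p] by simp
    have sg: "sign (map_permutation A g p) = sign p"
      using sign_map_permutation[of g A p] p g B h
      by (metis bij_betw_def bij_betw_finite)
    have "(\<Prod>x\<in>A. f x (p x)) = (\<Prod>i\<in>B. f (h i) (p (h i)))"
      using prod.reindex_bij_betw[OF h, of "\<lambda>x. f x (p x)"] by simp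
    also have "\<dots> = (\<Prod>i\<in>B. f (h i) (h (map_permutation A g p i)))"
    proof (intro prod.cong refl)
      fix i assume i: "i \<in> B"
      then have hi: "h i \<in> A" using img by auto
      have "map_permutation A g p (g (h i)) = g (p (h i))"
        by (rule map_permutation_apply) (use g hi in \<open>auto simp: bij_betw_def\<close>)
      then show "f (h i) (p (h i)) = f (h i) (h (map_permutation A g p i))"
        using gh[OF i] hg permutes_in_image[OF p, of "h i"] hi by simp
    qed
    finally show "of_int (sign (map_permutation A g p)) *
        (\<Prod>x\<in>B. f (h x) (h (map_permutation A g p x))) = of_int (sign p) * (\<Prod>x\<in>A. f x (p x))"
      using sg by simp
  next
    fix p assume "p \<in> {p. p permutes B}"
    then have p: "p permutes B" by simp
    show "map_permutation A g (map_permutation B h p) = p"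
      by (rule map_permutation_compose_inv[OF h p]) (use gh in auto)
    show "map_permutation B h p \<in> {p. p permutes A}"
      using map_permutation_permutes[OF h p] by simp
  qed
qed

lemma fdet_mat: "fdet {0..<n} (\<lambda>i j. f i j) = det (mat n n (\<lambda>(i, j). f i j))"
proof -
  have "det (mat n n (\<lambda>(i, j). f i j)) = (\<Sum>p | p permutes {0..<n}.
     signof p * (\<Prod>i = 0..<n. mat n n (\<lambda>(i, j). f i j) $$ (i, p i)))"
    by (rule det_def') simp
  also have "\<dots> = (\<Sum>p | p permutes {0..<n}. of_int (sign p) * (\<Prod>i = 0..<n. f i (p i)))"
    by (intro sum.cong refl arg_cong2[where f = "(*)"] prod.cong)
       (auto simp: dest: permutes_in_image)
  finally show ?thesis by (simp add: fdet_def)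
qed

lemma fdet_transpose:
  assumes "finite A"
  shows "fdet A (\<lambda>x y. f y x) = fdet A f"
proof -
  have "fdet A (\<lambda>x y. f y x) = (\<Sum>p | p permutes A. of_int (sign (Hilbert_Choice.inv p)) * (\<Prod>x\<in>A. f (Hilbert_Choice.inv p x) x))"
    unfolding fdet_def
    by (rule sum.reindex_bij_witness[where i = Hilbert_Choice.inv and j = Hilbert_Choice.inv])
       (auto simp: permutes_inv permutes_inv_inv)
  also have "\<dots> = fdet A f"
    unfolding fdet_def
  proof (intro sum.cong refl arg_cong2[where f = "(*)"])
    fix p assume "p \<in> {p. p permutes A}"
    then have p: "p permutes A" by simp
    show "of_int (sign (Hilbert_Choice.inv p)) = (of_int (sign p) :: 'b)"
      by (subst sign_inverse) (use permutation_permutes p assms in blast, simp)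
    show "(\<Prod>x\<in>A. f (Hilbert_Choice.inv p x) x) = (\<Prod>x\<in>A. f x (p x))"
      using prod.permute[OF p, of "\<lambda>x. f (Hilbert_Choice.inv p x) x"] permutes_inverses(2)[OF p]
      by (simp add: o_def)
  qed
  finally show ?thesis .
qed

section \<open>Row and column operations\<close>

lemma fdet_linear_row:
  assumes "finite A" "a \<in> A"
  shows "fdet A (f(a := \<lambda>y. u y + k * v y)) = fdet A (f(a := u)) + k * fdet A (f(a := v))"
proof -
  have *: "(\<Prod>x\<in>A. (f(a := w)) x (p x)) = w (p a) * (\<Prod>x\<in>A - {a}. f x (p x))" for w p
    by (subst prod.remove[OF assms]) (auto intro!: prod.cong)
  show ?thesis
    unfolding fdet_def * sum_distrib_left sum.distrib[symmetric]
    by (intro sum.cong refl) (simp add: algebra_simps)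
qed

lemma fdet_identical_rows:
  assumes A: "finite A" "a \<in> A" "b \<in> A" "a \<noteq> b" and eq: "\<And>y. y \<in> A \<Longrightarrow> f a y = f b y"
  shows "fdet A f = 0"
proof -
  obtain h where h: "bij_betw h {0..<card A} A"
    using ex_bij_betw_nat_finite[OF A(1)] by blast
  have "a \<in> h ` {0..<card A}" "b \<in> h ` {0..<card A}"
    using A h by (auto simp: bij_betw_def)
  then obtain i j where ij: "i < card A" "j < card A" "h i = a" "h j = b"
    by auto
  have "fdet A f = det (mat (card A) (card A) (\<lambda>(i, j). f (h i) (h j)))"
    using fdet_reindex[OF h finite_atLeastLessThan, of f] fdet_mat[of "card A" "\<lambda>i j. f (h i) (h j)"]
    by (simp only:)
  also have "\<dots> = 0"
  proof (rule det_identical_rows[of _ "card A" i j])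
    show "row (mat (card A) (card A) (\<lambda>(i, j). f (h i) (h j))) i =
      row (mat (card A) (card A) (\<lambda>(i, j). f (h i) (h j))) j"
      using ij h by (intro eq_vecI) (auto simp: eq bij_betw_apply)
  qed (use ij A(4) in auto)
  finally show ?thesis .
qed

lemma fdet_row_add:
  assumes A: "finite A" "a \<in> A" "b \<in> A" "a \<noteq> b"
  shows "fdet A (f(a := \<lambda>y. f a y + k * f b y)) = fdet A f"
proof -
  have "fdet A (f(a := f b)) = 0"
    by (rule fdet_identical_rows[OF A]) (use A in auto)
  then show ?thesis
    using fdet_linear_row[OF A(1,2), of f "f a" k "f b"] by simp
qed

lemma fdet_rows_add:
  assumes A: "finite A" "b \<in> A" "B \<subseteq> A - {b}"
  shows "fdet A (\<lambda>x y. if x \<in> B then f x y + k x * f b y else f x y) = fdet A f"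
proof -
  have "finite B" using A(1) finite_subset[OF A(3)] by simp
  then show ?thesis using A(3)
  proof (induction B)
    case empty
    then show ?case by simp
  next
    case (insert a B)
    let ?g = "\<lambda>x y. if x \<in> B then f x y + k x * f b y else f x y"
    have "(\<lambda>x y. if x \<in> insert a B then f x y + k x * f b y else f x y) =
       ?g(a := \<lambda>y. ?g a y + k a * ?g b y)"
      using insert by (auto simp: fun_eq_iff)
    moreover have "fdet A (?g(a := \<lambda>y. ?g a y + k a * ?g b y)) = fdet A ?g"
      by (rule fdet_row_add) (use insert A in auto)
    moreover have "fdet A ?g = fdet A f"
      by (rule insert.IH) (use insert in auto)
    ultimately show ?case by (simp only:)
  qed
qed

lemma fdet_cols_add:
  assumes A: "finite A" "b \<in> A" "B \<subseteq> A - {b}"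
  shows "fdet A (\<lambda>x y. if y \<in> B then f x y + k y * f x b else f x y) = fdet A f"
  using fdet_rows_add[OF A, of "\<lambda>x y. f y x" k] fdet_transpose[OF A(1), of f]
    fdet_transpose[OF A(1), of "\<lambda>x y. if y \<in> B then f x y + k y * f x b else f x y"]
  by simp

text \<open>A quarter turn in the plane of two rows is a product of three shears, that is, of three
  row additions.\<close>

lemma fdet_rotate_rows:
  assumes A: "finite A" "a \<in> A" "b \<in> A" "a \<noteq> b"
  shows "fdet A (f(a := \<lambda>y. - f b y, b := f a)) = fdet A f"
proof -
  define g1 where "g1 = f(a := \<lambda>y. f a y + (-1) * f b y)"
  define g2 where "g2 = g1(b := \<lambda>y. g1 b y + 1 * g1 a y)"
  define g3 where "g3 = g2(a := \<lambda>y. g2 a y + (-1) * g2 b y)"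
  have "g3 = f(a := \<lambda>y. - f b y, b := f a)"
    using A(4) by (auto simp: g1_def g2_def g3_def fun_eq_iff)
  then show ?thesis
    using fdet_row_add[OF A, of g2 "-1"] fdet_row_add[OF A(1,3,2) A(4)[symmetric], of g1 1]
      fdet_row_add[OF A, of f "-1"]
    unfolding g1_def[symmetric] g2_def[symmetric] g3_def[symmetric] by simp
qed

text \<open>Conjugation by a diagonal matrix of signs. With \<open>s\<close> depending on whether
  the content exceeds \<open>c\<close>, it negates exactly the entries that link the two sides of
  \<open>c\<close>.\<close>

lemma fdet_scale_blocks:
  assumes A: "finite A" and s: "\<And>x. x \<in> A \<Longrightarrow> s x * s x = 1"
  shows "fdet A (\<lambda>x y. s x * s y * f x y) = fdet A f"
  unfolding fdet_def
proof (intro sum.cong refl arg_cong2[where f = "(*)"])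
  fix p assume "p \<in> {p. p permutes A}"
  then have p: "p permutes A" by simp
  have "(\<Prod>x\<in>A. s x * s (p x) * f x (p x)) = (\<Prod>x\<in>A. s x) * (\<Prod>x\<in>A. s (p x)) * (\<Prod>x\<in>A. f x (p x))"
    by (simp add: prod.distrib)
  also have "(\<Prod>x\<in>A. s (p x)) = (\<Prod>x\<in>A. s x)"
    using prod.permute[OF p, of s] by (simp add: o_def)
  also have "(\<Prod>x\<in>A. s x) * (\<Prod>x\<in>A. s x) = 1"
    by (simp add: prod.distrib[symmetric] s)
  finally show "(\<Prod>x\<in>A. s x * s (p x) * f x (p x)) = (\<Prod>x\<in>A. f x (p x))" by simp
qed

section \<open>Deleting an index from a determinant\<close>

lemma fdet_remove_fixed_point:
  assumes A: "finite A" "a \<in> A" and f: "f a a = 1"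
    and moved: "\<And>p. p permutes A \<Longrightarrow> p a \<noteq> a \<Longrightarrow> \<exists>x\<in>A. f x (p x) = 0"
  shows "fdet A f = fdet (A - {a}) f"
proof -
  have "fdet A f = (\<Sum>p | p permutes (A - {a}). of_int (sign p) * (\<Prod>x\<in>A. f x (p x)))"
    unfolding fdet_def
  proof (rule sum.mono_neutral_right)
    show "finite {p. p permutes A}" using A finite_permutations by blast
    show "{p. p permutes A - {a}} \<subseteq> {p. p permutes A}"
      by (auto intro: permutes_subset)
    show "\<forall>p\<in>{p. p permutes A} - {p. p permutes A - {a}}. of_int (sign p) * (\<Prod>x\<in>A. f x (p x)) = 0"
    proof
      fix p assume p: "p \<in> {p. p permutes A} - {p. p permutes A - {a}}"
      then have "p a \<noteq> a" by (metis DiffD1 DiffD2 Diff_iff mem_Collect_eq permutes_superset singletonD)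
      then have "\<exists>x\<in>A. f x (p x) = 0" using p moved by simp
      then have "(\<Prod>x\<in>A. f x (p x)) = 0"
        using A by (intro prod_zero) auto
      then show "of_int (sign p) * (\<Prod>x\<in>A. f x (p x)) = 0" by simp
    qed
  qed
  also have "\<dots> = fdet (A - {a}) f"
    unfolding fdet_def
  proof (intro sum.cong refl arg_cong2[where f = "(*)"])
    fix p assume "p \<in> {p. p permutes A - {a}}"
    then have "p a = a" by (auto simp: permutes_def)
    then show "(\<Prod>x\<in>A. f x (p x)) = (\<Prod>x\<in>A - {a}. f x (p x))"
      by (subst prod.remove[OF A]) (simp add: f)
  qed
  finally show ?thesis .
qed

lemma fdet_remove_unit_row:
  assumes A: "finite A" "a \<in> A" and f: "f a a = 1" "\<And>y. y \<in> A - {a} \<Longrightarrow> f a y = 0"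
  shows "fdet A f = fdet (A - {a}) f"
proof (rule fdet_remove_fixed_point[where f = f, OF A f(1)])
  fix p assume "p permutes A" "p a \<noteq> a"
  then have "p a \<in> A - {a}" using A permutes_in_image[of p A a] by simp
  then show "\<exists>x\<in>A. f x (p x) = 0" using A f(2) by blast
qed

text \<open>Rotating the columns \<open>a\<close> and \<open>b\<close> brings the \<open>-1\<close>
  to position \<open>(a, a)\<close> as \<open>1\<close>, so that row \<open>a\<close> becomes a unit
  row. Column \<open>b\<close> is left with the former column \<open>a\<close>: the predecessor
  \<open>b\<close> takes over the role of \<open>a\<close>.\<close>

lemma fdet_contract:
  assumes A: "finite A" "a \<in> A" "b \<in> A" "a \<noteq> b"
    and f: "\<And>y. y \<in> A \<Longrightarrow> f a y = (if y = b then -1 else 0)"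
  shows "fdet A f = fdet (A - {a}) (\<lambda>x y. f x (if y = b then a else y))"
proof -
  define g where "g = (\<lambda>x y. if y = a then - f x b else if y = b then f x a else f x y)"
  have "fdet A f = fdet A (\<lambda>x y. f y x)" by (rule fdet_transpose[OF A(1), symmetric])
  also have "\<dots> = fdet A ((\<lambda>x y. f y x)(a := \<lambda>y. - (\<lambda>x y. f y x) b y, b := (\<lambda>x y. f y x) a))"
    using fdet_rotate_rows[OF A, of "\<lambda>x y. f y x"] by (simp only:)
  also have "\<dots> = fdet A (\<lambda>x y. g y x)"
    by (rule fdet_cong) (use A in \<open>auto simp: g_def\<close>)
  also have "\<dots> = fdet A g" by (rule fdet_transpose[OF A(1)])
  also have "\<dots> = fdet (A - {a}) g"
    by (rule fdet_remove_unit_row) (use A f in \<open>auto simp: g_def\<close>)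
  also have "\<dots> = fdet (A - {a}) (\<lambda>x y. f x (if y = b then a else y))"
    by (rule fdet_cong) (auto simp: g_def)
  finally show ?thesis .
qed

text \<open>The signed cycle \<open>(r\<^sub>s, \<dots>, r\<^sub>t) \<mapsto> (-r\<^sub>s\<^sub>+\<^sub>1, \<dots>, -r\<^sub>t, r\<^sub>s)\<close> is a product of plane rotations.\<close>

lemma fdet_signed_cycle_rows:
  fixes h :: "int \<Rightarrow> 'i" and s t :: int
  assumes A: "finite A" and h: "inj h" "h ` {s..t} \<subseteq> A" and st: "s \<le> t"
    and f': "\<And>i y. s \<le> i \<Longrightarrow> i < t \<Longrightarrow> y \<in> A \<Longrightarrow> f' (h i) y = - f (h (i + 1)) y"
      "\<And>y. y \<in> A \<Longrightarrow> f' (h t) y = f (h s) y"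
      "\<And>x y. x \<in> A - h ` {s..t} \<Longrightarrow> y \<in> A \<Longrightarrow> f' x y = f x y"
  shows "fdet A f' = fdet A f"
  using st h(2) f'
proof (induction t arbitrary: f' rule: int_ge_induct)
  case base
  show ?case
  proof (rule fdet_cong)
    fix x y assume "x \<in> A" "y \<in> A"
    then show "f' x y = f x y" using base by (cases "x = h s") auto
  qed
next
  case (step t)
  \<comment> \<open>The cycle up to \<open>t\<close> with row \<open>h (t + 1)\<close> still in
    place; one more rotation, of rows \<open>h t\<close> and \<open>h (t + 1)\<close>, completes
    it.\<close>
  define g where "g = (\<lambda>x. if x = h (t + 1) then f (h (t + 1)) else if x = h t then f (h s) else f' x)"
  have hne: "h t \<noteq> h (t + 1)" using h(1) by (auto dest: injD)
  have ht: "h t \<in> A" "h (t + 1) \<in> A" using step by auto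
  have heq: "h i = h j \<longleftrightarrow> i = j" for i j using h(1) by (auto dest: injD)
  have "fdet A f' = fdet A (g(h t := \<lambda>y. - g (h (t + 1)) y, h (t + 1) := g (h t)))"
  proof (rule fdet_cong)
    fix x y assume "x \<in> A" "y \<in> A"
    then show "f' x y = (g(h t := \<lambda>y. - g (h (t + 1)) y, h (t + 1) := g (h t))) x y"
      using hne step.prems(2)[of t y] step.prems(3)[of y] step.hyps by (auto simp: g_def)
  qed
  also have "\<dots> = fdet A g" by (rule fdet_rotate_rows[OF A ht hne])
  also have "\<dots> = fdet A f"
  proof (rule step.IH)
    show "h ` {s..t} \<subseteq> A" using step.prems(1) by auto
    fix i y assume "s \<le> i" "i < t" "y \<in> A"
    then show "g (h i) y = - f (h (i + 1)) y"
      using step.prems(2)[of i y] by (simp add: g_def heq)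
  next
    fix y assume "y \<in> A"
    show "g (h t) y = f (h s) y" using hne by (simp add: g_def)
  next
    fix x y assume *: "x \<in> A - h ` {s..t}" "y \<in> A"
    then have "x \<noteq> h t" using step.hyps by auto
    moreover have "x \<in> A - h ` {s..t+1}" if "x \<noteq> h (t + 1)"
      using * that step.hyps by (auto simp: heq)
    ultimately show "g x y = f x y"
      using step.prems(4)[of x y] * by (auto simp: g_def)
  qed
  finally show ?case .
qed

lemma fdet_signed_cycle_cols:
  fixes h :: "int \<Rightarrow> 'i" and s t :: int
  assumes A: "finite A" and h: "inj h" "h ` {s..t} \<subseteq> A" and st: "s \<le> t"
    and f': "\<And>i x. s \<le> i \<Longrightarrow> i < t \<Longrightarrow> x \<in> A \<Longrightarrow> f' x (h i) = - f x (h (i + 1))"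
      "\<And>x. x \<in> A \<Longrightarrow> f' x (h t) = f x (h s)"
      "\<And>x y. y \<in> A - h ` {s..t} \<Longrightarrow> x \<in> A \<Longrightarrow> f' x y = f x y"
  shows "fdet A f' = fdet A f"
proof -
  have "fdet A (\<lambda>x y. f' y x) = fdet A (\<lambda>x y. f y x)"
    by (rule fdet_signed_cycle_rows[OF A h st]) (use f' in auto)
  then show ?thesis
    using fdet_transpose[OF A, of f] fdet_transpose[OF A, of f'] by (simp only:)
qed

section \<open>The matrix of a ribbon cutting\<close>

text \<open>Cells are encoded as pairs (content, row). \<open>pd G\<close> and \<open>sc G\<close> are the steps backwards and forwards
  along the ribbons when exactly the cells with content in \<open>G\<close> go right.\<close>

definition pd :: "int set \<Rightarrow> int \<times> int \<Rightarrow> int \<times> int" where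
  "pd G x = (fst x - 1, if fst x - 1 \<in> G then snd x else snd x + 1)"

definition sc :: "int set \<Rightarrow> int \<times> int \<Rightarrow> int \<times> int" where
  "sc G x = (fst x + 1, if fst x \<in> G then snd x else snd x - 1)"

text \<open>Head rows live on tail columns only, so contracting along the \<open>-1\<close> entries
  leaves head rows against tail columns, one of each per ribbon. The value \<open>-1\<close> instead
  of \<open>1\<close> is what makes each contraction free of sign.\<close>

definition strip_matrix ::
  "(int \<times> int) set \<Rightarrow> int set \<Rightarrow> (int \<Rightarrow> int \<Rightarrow> 'a::comm_ring_1) \<Rightarrow> int \<times> int \<Rightarrow> int \<times> int \<Rightarrow> 'a" where
  "strip_matrix D G R x y =
     (if pd G x \<in> D then (if y = pd G x then -1 else 0)
      else if sc G y \<in> D then 0 else R (fst x) (fst y))"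

lemma fst_pd [simp]: "fst (pd G x) = fst x - 1" by (simp add: pd_def)
lemma fst_sc [simp]: "fst (sc G x) = fst x + 1" by (simp add: sc_def)

lemma pd_sc [simp]: "pd G (sc G x) = x" by (simp add: pd_def sc_def prod_eq_iff)
lemma sc_pd [simp]: "sc G (pd G x) = x" by (simp add: pd_def sc_def prod_eq_iff)

section \<open>Switching the direction of one content\<close>

lemma strip_matrix_row_op:
  assumes D: "finite D" and h: "h \<in> D" "fst h = c + 1" "pd G h \<notin> D"
    and uniq: "\<And>x. x \<in> D \<Longrightarrow> fst x = c + 1 \<Longrightarrow> pd G x \<notin> D \<Longrightarrow> x = h"
    and R12: "\<And>p q. p \<le> c \<Longrightarrow> c < q \<Longrightarrow> R1 p q = R1 p c * R1 (c + 1) q - R2 p q"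
      "\<And>p q. \<not> (p \<le> c \<and> c < q) \<Longrightarrow> R1 p q = R2 p q"
    and R1: "R1 (c + 1) c = 1" "\<And>p q. p > q + 1 \<Longrightarrow> R1 p q = 0"
  shows "fdet D (strip_matrix D G R1) = fdet D (\<lambda>x y.
     if fst x \<le> c then
       (if pd G x \<in> D then (if y = pd G x then -1 else 0)
        else if sc G y \<in> D \<or> fst y = c then 0 else R2 (fst x) (fst y))
     else if fst x = c + 1 then
       (if x = h then (if sc G y \<in> D \<or> fst y < c then 0 else if fst y = c then -1 else R1 (c + 1) (fst y))
        else (if y = pd G x then 1 else 0))
     else strip_matrix D G R1 x y)" (is "_ = fdet D ?P")
proof -
  let ?N = "strip_matrix D G R1"
  \<comment> \<open>\<open>B\<close> consists of the heads up to content \<open>c\<close>.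
    Subtracting \<open>R1 (fst x) c\<close> times row \<open>h\<close> cancels their entries at
    tails of content \<open>c\<close>, since \<open>R1 (c + 1) c = 1\<close>, and turns
    \<open>R1 p q\<close> into \<open>- R2 p q\<close> for \<open>q > c\<close>. Row
    \<open>h\<close> vanishes at contents below \<open>c\<close>, so the entries there stay. The
    signs \<open>s\<close> finally turn \<open>- R2\<close> into \<open>R2\<close>.\<close>
  define B where "B = {x \<in> D. fst x \<le> c \<and> pd G x \<notin> D}"
  define N1 where "N1 = (\<lambda>x y. if x \<in> B then ?N x y + (- R1 (fst x) c) * ?N h y else ?N x y)"
  define s where "s = (\<lambda>x::int \<times> int. if fst x > c then - 1 else (1::'a))"
  have "fdet D ?N = fdet D N1"
    unfolding N1_def by (rule fdet_rows_add[symmetric]) (use D h in \<open>auto simp: B_def\<close>)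
  also have "\<dots> = fdet D (\<lambda>x y. s x * s y * N1 x y)"
    by (rule fdet_scale_blocks[symmetric]) (auto simp: D s_def)
  also have "\<dots> = fdet D ?P"
  proof (rule fdet_cong)
    fix x y assume xy: "x \<in> D" "y \<in> D"
    consider (B) "x \<in> B" | (L) "fst x \<le> c" "pd G x \<in> D" | (h) "x = h"
      | (M) "fst x = c + 1" "pd G x \<in> D" "x \<noteq> h" | (U) "fst x > c + 1"
    proof -
      have "fst x \<le> c \<or> fst x = c + 1 \<or> fst x > c + 1" by linarith
      then show ?thesis using that xy uniq[of x] unfolding B_def by blast
    qed
    then show "s x * s y * N1 x y = ?P x y"
    proof cases
      case B
      then have x: "fst x \<le> c" "pd G x \<notin> D" by (auto simp: B_def)
      show ?thesis
      proof (cases "sc G y \<in> D")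
        case True
        then show ?thesis using B x h by (simp add: N1_def strip_matrix_def)
      next
        case False
        then have N1: "s x * s y * N1 x y =
            s y * (R1 (fst x) (fst y) - R1 (fst x) c * R1 (c + 1) (fst y))"
          and P: "?P x y = (if fst y = c then 0 else R2 (fst x) (fst y))"
          using B x h by (simp_all add: N1_def s_def strip_matrix_def)
        consider "fst y < c" | "fst y = c" | "fst y > c" by linarith
        then show ?thesis
        proof cases
          case 1
          then show ?thesis unfolding N1 P using R1(2)[of "fst y" "c + 1"] R12(2)[of "fst x" "fst y"]
            by (simp add: s_def)
        next
          case 2
          then show ?thesis unfolding N1 P by (simp add: R1)
        next
          case 3
          then show ?thesis unfolding N1 P using R12(1)[OF x(1) 3] by (simp add: s_def)
        qed
      qed
    next
      case L
      then have "x \<notin> B" by (simp add: B_def)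
      then have "N1 x y = (if y = pd G x then -1 else 0)" using L by (simp add: N1_def strip_matrix_def)
      then show ?thesis using L by (simp add: s_def)
    next
      case h
      then have "N1 x y = strip_matrix D G R1 h y" using assms(3) by (simp add: N1_def B_def)
      then have N1: "N1 x y = (if sc G y \<in> D then 0 else R1 (c + 1) (fst y))"
        using assms(3,4) by (simp add: strip_matrix_def)
      consider "fst y < c" | "fst y = c" | "fst y > c" by linarith
      then show ?thesis unfolding N1 using h assms(3) R1(1) R1(2)[of "fst y" "c + 1"]
        by cases (simp_all add: s_def)
    next
      case M
      then have "N1 x y = (if y = pd G x then -1 else 0)" by (simp add: N1_def B_def strip_matrix_def)
      then show ?thesis using M by (simp add: s_def)
    next
      case U
      then have N1: "N1 x y = strip_matrix D G R1 x y" by (simp add: N1_def B_def)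
      have "s x * s y * strip_matrix D G R1 x y = strip_matrix D G R1 x y"
        using U R1(2)[of "fst y" "fst x"] by (simp add: s_def strip_matrix_def)
      then show ?thesis unfolding N1 using U by simp
    qed
  qed
  finally show ?thesis .
qed

text \<open>After the row operation the only nonzero entry of column \<open>t\<close> is the
  \<open>-1\<close> in row \<open>h\<close>. Adding multiples of this column to the later tail
  columns clears row \<open>h\<close>, which then looks as if \<open>t\<close> were the predecessor
  of \<open>h\<close>.\<close>

lemma strip_matrix_row_col_op:
  assumes D: "finite D" and h: "h \<in> D" "fst h = c + 1" "pd G h \<notin> D"
    and uniq: "\<And>x. x \<in> D \<Longrightarrow> fst x = c + 1 \<Longrightarrow> pd G x \<notin> D \<Longrightarrow> x = h"
    and t: "t \<in> D" "fst t = c" "sc G t \<notin> D"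
    and uniqt: "\<And>y. y \<in> D \<Longrightarrow> fst y = c \<Longrightarrow> sc G y \<notin> D \<Longrightarrow> y = t"
    and R12: "\<And>p q. p \<le> c \<Longrightarrow> c < q \<Longrightarrow> R1 p q = R1 p c * R1 (c + 1) q - R2 p q"
      "\<And>p q. \<not> (p \<le> c \<and> c < q) \<Longrightarrow> R1 p q = R2 p q"
    and R1: "R1 (c + 1) c = 1" "\<And>p q. p > q + 1 \<Longrightarrow> R1 p q = 0"
  shows "fdet D (strip_matrix D G R1) = fdet D (\<lambda>x y.
     if fst x \<le> c then
       (if pd G x \<in> D then (if y = pd G x then -1 else 0)
        else if sc G y \<in> D \<or> fst y = c then 0 else R2 (fst x) (fst y))
     else if fst x = c + 1 then
       (if x = h then (if y = t then -1 else 0) else (if y = pd G x then 1 else 0))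
     else strip_matrix D G R1 x y)" (is "_ = fdet D ?Q")
proof -
  let ?P = "\<lambda>x y. if fst x \<le> c then
       (if pd G x \<in> D then (if y = pd G x then -1 else 0)
        else if sc G y \<in> D \<or> fst y = c then 0 else R2 (fst x) (fst y))
     else if fst x = c + 1 then
       (if x = h then (if sc G y \<in> D \<or> fst y < c then 0 else if fst y = c then -1 else R1 (c + 1) (fst y))
        else (if y = pd G x then 1 else 0))
     else strip_matrix D G R1 x y"
  define B where "B = {y \<in> D. c < fst y \<and> sc G y \<notin> D}"
  have "fdet D (strip_matrix D G R1) = fdet D ?P"
    by (rule strip_matrix_row_op[where ?R1.0 = R1 and ?R2.0 = R2, OF D h uniq R12 R1])
  also have "\<dots> = fdet D (\<lambda>x y. if y \<in> B then ?P x y + R1 (c + 1) (fst y) * ?P x t else ?P x y)"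
    by (rule fdet_cols_add[symmetric]) (use D t in \<open>auto simp: B_def\<close>)
  also have "\<dots> = fdet D ?Q"
  proof (rule fdet_cong)
    fix x y assume xy: "x \<in> D" "y \<in> D"
    have tpd: "t \<noteq> pd G x" using t xy by auto
    have "fst x \<le> c \<or> fst x = c + 1 \<or> fst x > c + 1" by linarith
    then consider (L) "fst x \<le> c" | (h) "x = h" | (M) "fst x = c + 1" "x \<noteq> h" | (U) "fst x > c + 1"
      by blast
    then show "(if y \<in> B then ?P x y + R1 (c + 1) (fst y) * ?P x t else ?P x y) = ?Q x y"
    proof cases
      case L
      then show ?thesis using tpd t(2) by simp
    next
      case h
      have P: "?P h y = (if sc G y \<in> D \<or> fst y < c then 0 else if fst y = c then -1 else R1 (c + 1) (fst y))"
        and Pt: "?P h t = -1" and Q: "?Q h y = (if y = t then -1 else 0)"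
        using t(2,3) assms(3) by simp_all
      consider "sc G y \<in> D" | "fst y < c" "sc G y \<notin> D" | "y = t" | "fst y > c" "sc G y \<notin> D"
        using uniqt[OF xy(2)] by force
      then show ?thesis unfolding h P Pt Q
        by cases (use t(2,3) in \<open>auto simp: B_def xy\<close>)
    next
      case M
      then show ?thesis using tpd by simp
    next
      case U
      then have "strip_matrix D G R1 x t = 0"
        using t tpd R1(2)[of c "fst x"] by (simp add: strip_matrix_def)
      then have "?P x t = 0" using U by simp
      then show ?thesis using U by simp
    qed
  qed
  finally show ?thesis .
qed

text \<open>For the case that diagonal \<open>c\<close> is the longer one. With no head at content
  \<open>c + 1\<close>, no row supplies the factors \<open>R1 (c + 1) q\<close>; instead they become
  the coefficients with which column \<open>t\<close> is subtracted.\<close>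

lemma strip_matrix_col_op:
  assumes D: "finite D" and t: "t \<in> D" "fst t = c" "sc G t \<notin> D"
    and noh: "\<And>x. x \<in> D \<Longrightarrow> fst x = c + 1 \<Longrightarrow> pd G x \<in> D"
    and R12: "\<And>p q. p \<le> c \<Longrightarrow> c < q \<Longrightarrow> R1 p q = R1 p c * R1 (c + 1) q - R2 p q"
      "\<And>p q. \<not> (p \<le> c \<and> c < q) \<Longrightarrow> R1 p q = R2 p q"
    and R1: "\<And>p q. p > q + 1 \<Longrightarrow> R1 p q = 0"
  shows "fdet D (strip_matrix D G R1) = fdet D (\<lambda>x y.
     if fst x = c + 1 then (if y = pd G x then 1 else 0)
     else strip_matrix D G R2 x y)" (is "_ = fdet D ?P")
proof -
  let ?N = "strip_matrix D G R1"
  define B where "B = {y \<in> D. c < fst y \<and> sc G y \<notin> D}"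
  define N1 where "N1 = (\<lambda>x y. if y \<in> B then ?N x y + (- R1 (c + 1) (fst y)) * ?N x t else ?N x y)"
  define s where "s = (\<lambda>x::int \<times> int. if fst x > c then - 1 else (1::'a))"
  have "fdet D ?N = fdet D N1"
    unfolding N1_def by (rule fdet_cols_add[symmetric]) (use D t in \<open>auto simp: B_def\<close>)
  also have "\<dots> = fdet D (\<lambda>x y. s x * s y * N1 x y)"
    by (rule fdet_scale_blocks[symmetric]) (auto simp: D s_def)
  also have "\<dots> = fdet D ?P"
  proof (rule fdet_cong)
    fix x y assume xy: "x \<in> D" "y \<in> D"
    have tpd: "t \<noteq> pd G x" using t xy by auto
    consider (H) "pd G x \<notin> D" | (M) "fst x = c + 1" "pd G x \<in> D" | (U) "fst x \<noteq> c + 1" "pd G x \<in> D"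
      by blast
    then show "s x * s y * N1 x y = ?P x y"
    proof cases
      case H
      then have ne: "fst x \<noteq> c + 1" using noh xy by blast
      show ?thesis
      proof (cases "sc G y \<in> D")
        case True
        then show ?thesis using H ne by (simp add: N1_def strip_matrix_def B_def)
      next
        case False
        then have N1: "s x * s y * N1 x y = s x * s y *
            (R1 (fst x) (fst y) - (if fst y > c then R1 (c + 1) (fst y) * R1 (fst x) c else 0))"
          and P: "?P x y = R2 (fst x) (fst y)"
          using H ne t xy by (simp_all add: N1_def strip_matrix_def B_def)
        consider "fst y \<le> c" "fst x \<le> c" | "fst y \<le> c" "fst x > c + 1"
          | "fst y > c" "fst x \<le> c" | "fst y > c" "fst x > c + 1" using ne by linarith
        then show ?thesis
        proof cases
          case 1
          then show ?thesis unfolding N1 P using R12(2)[of "fst x" "fst y"] by (simp add: s_def)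
        next
          case 2
          then show ?thesis unfolding N1 P using R12(2)[of "fst x" "fst y"] R1[of "fst y" "fst x"]
            by (simp add: s_def)
        next
          case 3
          then show ?thesis unfolding N1 P using R12(1)[OF 3(2,1)] by (simp add: s_def)
        next
          case 4
          then show ?thesis unfolding N1 P using R12(2)[of "fst x" "fst y"] R1[of c "fst x"]
            by (simp add: s_def)
        qed
      qed
    next
      case M
      then have "N1 x y = (if y = pd G x then -1 else 0)" using tpd by (simp add: N1_def strip_matrix_def)
      then show ?thesis using M by (simp add: s_def)
    next
      case U
      then have "N1 x y = (if y = pd G x then -1 else 0)" using tpd by (simp add: N1_def strip_matrix_def)
      then show ?thesis using U by (simp add: s_def strip_matrix_def)
    qed
  qed
  finally show ?thesis .
qed

text \<open>\<open>R\<close> and \<open>R'\<close> agree on segments that do not pass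
  \<open>c\<close>, so the identity linking them is symmetric. Hence the operations may start from
  whichever cutting has the extra ribbon: \<open>insert c G\<close> in case \<open>A\<close>,
  \<open>G\<close> in case \<open>B\<close>.\<close>

lemma strip_matrix_toggle:
  assumes D: "finite D" and cG: "c \<notin> G"
    and dc: "\<And>i. (c, i) \<in> D \<longleftrightarrow> s \<le> i \<and> i < t" and dc': "\<And>i. (c + 1, i) \<in> D \<longleftrightarrow> s' \<le> i \<and> i < t'"
    and st: "s < t" "s' < t'" "s' = s \<or> s' = s - 1" "t' = t \<or> t' = t - 1"
    and R': "\<And>p q. p \<le> c \<Longrightarrow> c < q \<Longrightarrow> R' p q = R p c * R (c + 1) q - R p q"
      "\<And>p q. \<not> (p \<le> c \<and> c < q) \<Longrightarrow> R' p q = R p q"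
    and R: "R (c + 1) c = 1" "\<And>p q. p > q + 1 \<Longrightarrow> R p q = 0"
  shows "fdet D (strip_matrix D (insert c G) R') = fdet D (strip_matrix D G R)"
proof -
  let ?G' = "insert c G"
  have pd1: "pd G x = (c, snd x + 1)" "pd ?G' x = (c, snd x)" if "fst x = c + 1" for x
    using that cG by (simp_all add: pd_def)
  have pd2: "pd ?G' x = pd G x" if "fst x \<noteq> c + 1" for x
    using that by (auto simp: pd_def)
  have sc1: "sc G x = (c + 1, snd x - 1)" "sc ?G' x = (c + 1, snd x)" if "fst x = c" for x
    using that cG by (simp_all add: sc_def)
  have sc2: "sc ?G' x = sc G x" if "fst x \<noteq> c" for x
    using that by (auto simp: sc_def)
  have in_c: "x \<in> D \<longleftrightarrow> s \<le> snd x \<and> snd x < t" if "fst x = c" for x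
    using dc[of "snd x"] that by (metis prod.collapse)
  have in_c': "x \<in> D \<longleftrightarrow> s' \<le> snd x \<and> snd x < t'" if "fst x = c + 1" for x
    using dc'[of "snd x"] that by (metis prod.collapse)
  have R'1: "R' p q = R' p c * R' (c + 1) q - R p q" if "p \<le> c" "c < q" for p q
    using R'(1)[OF that] R'(2)[of p c] R'(2)[of "c + 1" q] by simp
  have R1: "R p q = R p c * R (c + 1) q - R' p q" if "p \<le> c" "c < q" for p q
    using R'(1)[OF that] by simp
  have R'0: "R' p q = 0" if "p > q + 1" for p q
    using R'(2)[of p q] R(2)[of q p] that by auto
  have R'c: "R' (c + 1) c = 1" using R'(2)[of "c + 1" c] R(1) by simp
  have img: "(\<lambda>i. (c + 1, i)) ` {s'..t' - 1} \<subseteq> D"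
    by (intro image_subsetI) (simp add: dc')
  have inj: "inj (\<lambda>i::int. (k, i))" for k :: int by (auto simp: inj_on_def)
  have nimg: "fst x \<noteq> c + 1" if "x \<in> D - (\<lambda>i. (c + 1, i)) ` {s'..t' - 1}" for x
  proof
    assume "fst x = c + 1"
    then have "x = (c + 1, snd x)" "snd x \<in> {s'..t' - 1}"
      using that in_c'[of x] by (simp_all add: prod_eq_iff)
    then show False using that by blast
  qed
  have above: "strip_matrix D ?G' R' x y = strip_matrix D G R x y" if "fst x > c + 1" for x y
    using that pd2[of x] sc2[of y] R(2)[of "fst y" "fst x"] R'0[of "fst y" "fst x"] R'(2)[of "fst x" "fst y"]
    by (cases "fst y = c") (simp_all add: strip_matrix_def)
  consider (A) "s' = s - 1" "t' = t - 1" | (B) "s' = s" "t' = t"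
    | (C) "s' = s - 1" "t' = t" | (D) "s' = s" "t' = t - 1" using st by blast
  then show ?thesis
  proof cases
    case A
    \<comment> \<open>Going up matches the two diagonals completely. Going right leaves the top cell
      of diagonal \<open>c + 1\<close> without predecessor and the bottom cell of diagonal
      \<open>c\<close> without successor.\<close>
    let ?h = "(c + 1, s - 1)" and ?t = "(c, t - 1)"
    let ?Q = "\<lambda>x y. if fst x \<le> c then
       (if pd ?G' x \<in> D then (if y = pd ?G' x then -1 else 0)
        else if sc ?G' y \<in> D \<or> fst y = c then 0 else R (fst x) (fst y))
     else if fst x = c + 1 then
       (if x = ?h then (if y = ?t then -1 else 0) else (if y = pd ?G' x then 1 else 0))
     else strip_matrix D ?G' R' x y"
    have "fdet D (strip_matrix D ?G' R') = fdet D ?Q"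
    proof (rule strip_matrix_row_col_op[where ?R1.0 = R' and ?R2.0 = R, OF D _ _ _ _ _ _ _ _ R'1 R'(2) R'c R'0])
      show "?h \<in> D" "pd ?G' ?h \<notin> D" "?t \<in> D" "sc ?G' ?t \<notin> D"
        using A st by (simp_all add: pd1 sc1 dc dc')
      show "x = ?h" if "x \<in> D" "fst x = c + 1" "pd ?G' x \<notin> D" for x
        using that A st by (auto simp: pd1 dc in_c' prod_eq_iff)
      show "x = ?t" if "x \<in> D" "fst x = c" "sc ?G' x \<notin> D" for x
        using that A st by (auto simp: sc1 dc' in_c prod_eq_iff)
    qed simp_all
    also have "\<dots> = fdet D (strip_matrix D G R)"
    proof (rule fdet_signed_cycle_rows[OF D inj img, symmetric])
      fix i y assume i: "s' \<le> i" "i < t' - 1"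
      then have "pd G (c + 1, i) \<in> D" using A by (simp add: pd1 dc)
      then show "strip_matrix D G R (c + 1, i) y = - ?Q (c + 1, i + 1) y"
        using i A by (simp add: strip_matrix_def pd1)
    next
      fix y
      have "pd G (c + 1, t' - 1) \<in> D" using A st by (simp add: pd1 dc)
      then show "strip_matrix D G R (c + 1, t' - 1) y = ?Q (c + 1, s') y"
        using A by (simp add: strip_matrix_def pd1)
    next
      fix x y assume x: "x \<in> D - (\<lambda>i. (c + 1, i)) ` {s'..t' - 1}" and y: "y \<in> D"
      have "sc G y \<in> D" if "fst y = c" using that y A in_c[of y] by (simp add: sc1 dc')
      then show "strip_matrix D G R x y = ?Q x y"
        using nimg[OF x] above[of x y] sc2[of y]
        by (cases "fst x \<le> c"; cases "fst y = c") (simp_all add: strip_matrix_def pd2)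
    qed (use st in simp)
    finally show ?thesis .
  next
    case B
    \<comment> \<open>Here going right matches the diagonals, and going up leaves the bottom cell of
      diagonal \<open>c + 1\<close> as a head and the top cell of diagonal \<open>c\<close> as a
      tail.\<close>
    let ?h = "(c + 1, t - 1)" and ?t = "(c, s)"
    let ?Q = "\<lambda>x y. if fst x \<le> c then
       (if pd G x \<in> D then (if y = pd G x then -1 else 0)
        else if sc G y \<in> D \<or> fst y = c then 0 else R' (fst x) (fst y))
     else if fst x = c + 1 then
       (if x = ?h then (if y = ?t then -1 else 0) else (if y = pd G x then 1 else 0))
     else strip_matrix D G R x y"
    have "fdet D (strip_matrix D G R) = fdet D ?Q"
    proof (rule strip_matrix_row_col_op[where ?R1.0 = R and ?R2.0 = R', OF D _ _ _ _ _ _ _ _ R1 R'(2)[symmetric] R])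
      show "?h \<in> D" "pd G ?h \<notin> D" "?t \<in> D" "sc G ?t \<notin> D"
        using B st by (simp_all add: pd1 sc1 dc dc')
      show "x = ?h" if "x \<in> D" "fst x = c + 1" "pd G x \<notin> D" for x
        using that B st by (auto simp: pd1 dc in_c' prod_eq_iff)
      show "x = ?t" if "x \<in> D" "fst x = c" "sc G x \<notin> D" for x
        using that B st by (auto simp: sc1 dc' in_c prod_eq_iff)
    qed simp_all
    also have "\<dots> = fdet D (strip_matrix D ?G' R')"
    proof (rule fdet_signed_cycle_rows[OF D inj img])
      fix i y assume i: "s' \<le> i" "i < t' - 1"
      then have "pd ?G' (c + 1, i + 1) \<in> D" using B by (simp add: pd1 dc)
      then show "?Q (c + 1, i) y = - strip_matrix D ?G' R' (c + 1, i + 1) y"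
        using i B by (simp add: strip_matrix_def pd1)
    next
      fix y
      have "pd ?G' (c + 1, s') \<in> D" using B st by (simp add: pd1 dc)
      then show "?Q (c + 1, t' - 1) y = strip_matrix D ?G' R' (c + 1, s') y"
        using B by (simp add: strip_matrix_def pd1)
    next
      fix x y assume x: "x \<in> D - (\<lambda>i. (c + 1, i)) ` {s'..t' - 1}" and y: "y \<in> D"
      have "sc ?G' y \<in> D" if "fst y = c" using that y B in_c[of y] by (simp add: sc1 dc')
      then show "?Q x y = strip_matrix D ?G' R' x y"
        using nimg[OF x] above[of x y] sc2[of y]
        by (cases "fst x \<le> c"; cases "fst y = c") (simp_all add: strip_matrix_def pd2)
    qed (use st in simp)
    finally show ?thesis by simp
  next
    case C
    \<comment> \<open>No cell of content \<open>c\<close> is a tail in either cutting, so the row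
      operation suffices; the head moves between the top row \<open>s - 1\<close> and the bottom row
      \<open>t - 1\<close>.\<close>
    let ?h = "(c + 1, s - 1)"
    let ?P = "\<lambda>x y. if fst x \<le> c then
       (if pd ?G' x \<in> D then (if y = pd ?G' x then -1 else 0)
        else if sc ?G' y \<in> D \<or> fst y = c then 0 else R (fst x) (fst y))
     else if fst x = c + 1 then
       (if x = ?h then (if sc ?G' y \<in> D \<or> fst y < c then 0 else if fst y = c then -1 else R' (c + 1) (fst y))
        else (if y = pd ?G' x then 1 else 0))
     else strip_matrix D ?G' R' x y"
    have "fdet D (strip_matrix D ?G' R') = fdet D ?P"
    proof (rule strip_matrix_row_op[where ?R1.0 = R' and ?R2.0 = R, OF D _ _ _ _ R'1 R'(2) R'c R'0])
      show "?h \<in> D" "pd ?G' ?h \<notin> D"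
        using C st by (simp_all add: pd1 sc1 dc dc')
      show "x = ?h" if "x \<in> D" "fst x = c + 1" "pd ?G' x \<notin> D" for x
        using that C st by (auto simp: pd1 dc in_c' prod_eq_iff)
    qed simp_all
    also have "\<dots> = fdet D (strip_matrix D G R)"
    proof (rule fdet_signed_cycle_rows[OF D inj img, symmetric])
      fix i y assume i: "s' \<le> i" "i < t' - 1"
      then have "pd G (c + 1, i) \<in> D" using C by (simp add: pd1 dc)
      then show "strip_matrix D G R (c + 1, i) y = - ?P (c + 1, i + 1) y"
        using i C by (simp add: strip_matrix_def pd1)
    next
      fix y assume y: "y \<in> D"
      have sc: "sc G y \<in> D" "sc ?G' y \<in> D" if "fst y = c" using that y C in_c[of y] by (simp_all add: sc1 dc')
      have "pd G (c + 1, t' - 1) \<notin> D" using C st by (simp add: pd1 dc)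
      then show "strip_matrix D G R (c + 1, t' - 1) y = ?P (c + 1, s') y"
        using C sc sc2[of y] R(2)[of "fst y" "c + 1"] R'(2)[of "c + 1" "fst y"]
        by (cases "fst y = c"; cases "fst y < c") (simp_all add: strip_matrix_def pd1)
    next
      fix x y assume x: "x \<in> D - (\<lambda>i. (c + 1, i)) ` {s'..t' - 1}" and y: "y \<in> D"
      have "sc G y \<in> D" if "fst y = c" using that y C in_c[of y] by (simp add: sc1 dc')
      then show "strip_matrix D G R x y = ?P x y"
        using nimg[OF x] above[of x y] sc2[of y]
        by (cases "fst x \<le> c"; cases "fst y = c") (simp_all add: strip_matrix_def pd2)
    qed (use st in simp)
    finally show ?thesis .
  next
    case D
    \<comment> \<open>Every cell of content \<open>c + 1\<close> has a predecessor in both cuttings.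
      The tail of content \<open>c\<close> is at the bottom when going right and at the top when
      going up, so columns are cycled instead of rows.\<close>
    let ?t = "(c, t - 1)"
    let ?P = "\<lambda>x y. if fst x = c + 1 then (if y = pd ?G' x then 1 else 0) else strip_matrix D ?G' R x y"
    have imgc: "(\<lambda>i. (c, i)) ` {s..t - 1} \<subseteq> D"
      by (intro image_subsetI) (simp add: dc)
    have "fdet D (strip_matrix D ?G' R') = fdet D ?P"
    proof (rule strip_matrix_col_op[where ?R1.0 = R' and ?R2.0 = R, OF \<open>finite D\<close> _ _ _ _ R'1 R'(2) R'0])
      show "?t \<in> D" "sc ?G' ?t \<notin> D" using D st by (simp_all add: sc1 dc dc')
      show "pd ?G' x \<in> D" if "x \<in> D" "fst x = c + 1" for x
        using that D in_c' by (simp add: pd1 dc)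
    qed simp_all
    also have "\<dots> = fdet D (strip_matrix D G R)"
    proof (rule fdet_signed_cycle_cols[OF \<open>finite D\<close> inj imgc])
      fix i x assume i: "s \<le> i" "i < t - 1" and x: "x \<in> D"
      show "?P x (c, i) = - strip_matrix D G R x (c, i + 1)"
      proof (cases "fst x = c + 1")
        case True
        then have "pd G x \<in> D" using x D in_c' by (simp add: pd1 dc)
        then show ?thesis using True by (simp add: strip_matrix_def pd1)
      next
        case False
        then have "pd G x \<noteq> (c, k)" "(c, k) \<noteq> pd G x" for k by (auto simp: prod_eq_iff)
        then show ?thesis using False i D by (simp add: strip_matrix_def pd2 sc1 dc')
      qed
    next
      fix x assume x: "x \<in> D"
      show "?P x (c, t - 1) = strip_matrix D G R x (c, s)"
      proof (cases "fst x = c + 1")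
        case True
        then have "pd G x \<in> D" using x D in_c' by (simp add: pd1 dc)
        then show ?thesis using True D x in_c'[of x] by (simp add: strip_matrix_def pd1)
      next
        case False
        then have "pd G x \<noteq> (c, k)" "(c, k) \<noteq> pd G x" for k by (auto simp: prod_eq_iff)
        then show ?thesis using False D by (simp add: strip_matrix_def pd2 sc1 dc')
      qed
    next
      fix x y assume y: "y \<in> D - (\<lambda>i. (c, i)) ` {s..t - 1}" and x: "x \<in> D"
      have ny: "fst y \<noteq> c"
      proof
        assume "fst y = c"
        then have "y = (c, snd y)" "snd y \<in> {s..t - 1}"
          using y in_c[of y] by (simp_all add: prod_eq_iff)
        then show False using y by blast
      qed
      show "?P x y = strip_matrix D G R x y"
      proof (cases "fst x = c + 1")
        case True
        then have "pd G x \<in> D" using x D in_c' by (simp add: pd1 dc)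
        then show ?thesis using True ny by (auto simp: strip_matrix_def pd1)
      next
        case False
        then show ?thesis using ny by (simp add: strip_matrix_def pd2 sc2)
      qed
    qed (use st in simp)
    finally show ?thesis .
  qed
qed

section \<open>Ribbons and chains\<close>

text \<open>\<open>break_det E p cs q\<close> is the determinant of the ribbon with contents \<open>p, \<dots>, q\<close> whose columns end at the
  contents \<open>cs\<close>, expanded along the first column of its Hessenberg matrix.\<close>

primrec break_det :: "(int \<Rightarrow> int \<Rightarrow> 'a::comm_ring_1) \<Rightarrow> int \<Rightarrow> int list \<Rightarrow> int \<Rightarrow> 'a" where
  "break_det E p [] q = E p q"
| "break_det E p (c # cs) q = E p c * break_det E (c + 1) cs q - break_det E p cs q"

text \<open>The content \<open>q\<close> is left out because the segment stops there, whatever its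
  direction. For \<open>p > q\<close> there are no breaks and the value is \<open>E p q\<close>,
  which carries the conventions for empty and undefined segments.\<close>

definition ribbon_det :: "(int \<Rightarrow> int \<Rightarrow> 'a::comm_ring_1) \<Rightarrow> int set \<Rightarrow> int \<Rightarrow> int \<Rightarrow> 'a" where
  "ribbon_det E G p q = break_det E p (sorted_list_of_set (G \<inter> {p..<q})) q"

text \<open>The recursion expands at the first break. Each of its terms is linear in the remaining
  determinant, so the same rule passes to any later break, and contents can be switched in any
  order.\<close>

lemma break_det_split:
  "break_det E p (xs @ c # ys) q = break_det E p xs c * break_det E (c + 1) ys q - break_det E p (xs @ ys) q"
proof (induction xs arbitrary: p)
  case (Cons x xs)
  show ?case unfolding append_Cons break_det.simps Cons.IH by (simp add: algebra_simps)
qed simp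

lemma ribbon_det_empty [simp]: "ribbon_det E {} = E"
  by (simp add: ribbon_det_def fun_eq_iff)

lemma ribbon_det_insert_outside:
  assumes "\<not> (p \<le> c \<and> c < q)"
  shows "ribbon_det E (insert c G) p q = ribbon_det E G p q"
proof -
  have "insert c G \<inter> {p..<q} = G \<inter> {p..<q}" using assms by auto
  then show ?thesis by (simp add: ribbon_det_def)
qed

lemma ribbon_det_insert:
  assumes "c \<notin> G" "p \<le> c" "c < q"
  shows "ribbon_det E (insert c G) p q = ribbon_det E G p c * ribbon_det E G (c + 1) q - ribbon_det E G p q"
proof -
  have split: "x < c \<or> c + 1 \<le> x" if "x \<in> G" for x
    using that assms(1) by (cases "x = c") auto
  define A B where "A = G \<inter> {p..<c}" and "B = G \<inter> {c + 1..<q}"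
  have AB: "finite A" "finite B" "\<And>x. x \<in> A \<Longrightarrow> x < c" "\<And>x. x \<in> B \<Longrightarrow> c < x"
    by (auto simp: A_def B_def)
  have G: "G \<inter> {p..<q} = A \<union> B"
    unfolding A_def B_def using assms(2,3) by (auto dest: split)
  have G': "insert c G \<inter> {p..<q} = insert c (A \<union> B)"
    unfolding G[symmetric] using assms(2,3) by auto
  have lt: "x < y" if "x \<in> A" "y \<in> B" for x y using AB(3)[OF that(1)] AB(4)[OF that(2)] by simp
  have AB0: "A \<inter> B = {}" by (auto dest: lt)
  have "sorted_list_of_set X = sorted_list_of_set A @ c # sorted_list_of_set B"
    if "X = insert c (A \<union> B)" for X
  proof (rule sorted_distinct_set_unique)
    have "finite X" using that AB by simp
    then have "set (sorted_list_of_set X) = X" by simp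
    then show "set (sorted_list_of_set X) = set (sorted_list_of_set A @ c # sorted_list_of_set B)"
      using AB(1,2) that by simp
  qed (use AB(1,2) AB0 in \<open>auto simp: sorted_append dest: AB(3) AB(4) intro: less_imp_le lt\<close>)
  from this[OF refl]
  have "sorted_list_of_set (insert c (A \<union> B)) = sorted_list_of_set A @ c # sorted_list_of_set B" .
  moreover have "sorted_list_of_set (A \<union> B) = sorted_list_of_set A @ sorted_list_of_set B"
    by (rule sorted_distinct_set_unique)
       (use AB(1,2) AB0 in \<open>auto simp: sorted_append dest: lt AB(3) AB(4) intro: less_imp_le lt\<close>)
  ultimately show ?thesis
    unfolding ribbon_det_def G G' A_def[symmetric] B_def[symmetric]
    by (simp add: break_det_split)
qed

lemma strip_matrix_toggle_all:
  assumes D: "finite D" and G: "finite G"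
    and diag: "\<And>c. c \<in> G \<Longrightarrow> \<exists>s t s' t'. (\<forall>i. (c, i) \<in> D \<longleftrightarrow> s \<le> i \<and> i < t) \<and>
        (\<forall>i. (c + 1, i) \<in> D \<longleftrightarrow> s' \<le> i \<and> i < t') \<and> s < t \<and> s' < t' \<and>
        (s' = s \<or> s' = s - 1) \<and> (t' = t \<or> t' = t - 1)"
    and E: "\<And>p. E p (p - 1) = 1" "\<And>p q. p > q + 1 \<Longrightarrow> E p q = 0"
  shows "fdet D (strip_matrix D G (ribbon_det E G)) = fdet D (strip_matrix D {} E)"
  using G diag
proof (induction G)
  case empty
  then show ?case by simp
next
  case (insert c G)
  obtain s t s' t' where *: "\<And>i. (c, i) \<in> D \<longleftrightarrow> s \<le> i \<and> i < t" 
    "\<And>i. (c + 1, i) \<in> D \<longleftrightarrow> s' \<le> i \<and> i < t'" "s < t" "s' < t'" "s' = s \<or> s' = s - 1" "t' = t \<or> t' = t - 1"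
    using insert.prems[of c] by (metis insertI1)
  have "fdet D (strip_matrix D (insert c G) (ribbon_det E (insert c G))) = fdet D (strip_matrix D G (ribbon_det E G))"
  proof (rule strip_matrix_toggle[OF D insert.hyps(2) *])
    show "ribbon_det E G (c + 1) c = 1" using E(1)[of "c + 1"] by (simp add: ribbon_det_def)
    show "ribbon_det E G p q = 0" if "p > q + 1" for p q
      using that E(2)[OF that] by (simp add: ribbon_det_def)
    show "ribbon_det E (insert c G) p q = ribbon_det E G p c * ribbon_det E G (c + 1) q - ribbon_det E G p q"
      if "p \<le> c" "c < q" for p q using insert.hyps(2) that by (rule ribbon_det_insert)
    show "ribbon_det E (insert c G) p q = ribbon_det E G p q" if "\<not> (p \<le> c \<and> c < q)" for p q
      using that by (rule ribbon_det_insert_outside)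
  qed
  then show ?case using insert by auto
qed

section \<open>Contracting each ribbon to one index\<close>

lemma fdet_chain_contraction:
  assumes "finite D"
    and "\<And>x y. x \<in> D \<Longrightarrow> pd G x \<in> D \<Longrightarrow> y \<in> D \<Longrightarrow> M x y = (if y = pd G x then -1 else 0)"
    and "\<And>x. x \<in> D \<Longrightarrow> pd G x \<notin> D \<Longrightarrow>
       sc G (tc x) \<notin> D \<and> (\<exists>k. tc x = (sc G ^^ k) x \<and> (\<forall>j\<le>k. (sc G ^^ j) x \<in> D))"
  shows "fdet D M = fdet {x \<in> D. pd G x \<notin> D} (\<lambda>x y. M x (tc y))"
  using assms
proof (induction "card D" arbitrary: D M tc rule: less_induct)
  case less
  show ?case
  proof (cases "\<exists>x\<in>D. pd G x \<in> D")
    case False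
    then have H: "{x \<in> D. pd G x \<notin> D} = D" by blast
    have "tc x = x" if x: "x \<in> D" for x
    proof -
      obtain k where k: "tc x = (sc G ^^ k) x" "\<forall>j\<le>k. (sc G ^^ j) x \<in> D"
        using less.prems(3)[OF x] False x by blast
      show ?thesis
      proof (cases k)
        case 0
        then show ?thesis using k by simp
      next
        case (Suc m)
        then have "sc G x \<in> D" using k(2)[rule_format, of 1] by simp
        then have "pd G (sc G x) \<notin> D" using False by blast
        then show ?thesis using x by simp
      qed
    qed
    then show ?thesis unfolding H by (intro fdet_cong) simp
  next
    case True
    \<comment> \<open>Among the non-heads, \<open>m\<close> of largest content is contracted. No
      cell has \<open>m\<close> as its predecessor, so \<open>m\<close> ends its ribbon and the
      remaining cells still form chains.\<close>
    define T where "T = {x \<in> D. pd G x \<in> D}"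
    have T: "finite T" "T \<noteq> {}" using True less.prems(1) by (auto simp: T_def)
    have "Max (fst ` T) \<in> fst ` T" using T by simp
    then obtain m where m0: "m \<in> T" "Max (fst ` T) = fst m" by blast
    have m: "m \<in> T" "\<And>x. x \<in> T \<Longrightarrow> fst x \<le> fst m"
      using m0 T(1) by (simp_all flip: m0(2))
    have mD: "m \<in> D" "pd G m \<in> D" using m(1) by (auto simp: T_def)
    have pdm: "pd G x \<noteq> m" if "x \<in> D" for x
    proof
      assume "pd G x = m"
      then have "x \<in> T" "fst x = fst m + 1" using that mD by (auto simp: T_def)
      then show False using m(2)[of x] by simp
    qed
    have pd_inj: "x = x'" if "pd G x = pd G x'" for x x' using that sc_pd by metis
    define b where "b = pd G m"
    have b: "b \<in> D" "b \<noteq> m" "sc G b = m" using mD by (auto simp: b_def prod_eq_iff)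
    \<comment> \<open>Column \<open>b\<close> now carries the old column \<open>m\<close>, so
      \<open>b\<close> is the tail of the shortened chain.\<close>
    let ?D = "D - {m}" and ?M = "\<lambda>x y. M x (if y = b then m else y)"
    let ?tc = "\<lambda>x. if tc x = m then b else tc x"
    have H: "{x \<in> ?D. pd G x \<notin> ?D} = {x \<in> D. pd G x \<notin> D}"
      using pdm mD by auto
    have "fdet D M = fdet ?D ?M"
      by (rule fdet_contract) (use less.prems(1,2) mD b in \<open>auto simp: b_def\<close>)
    also have "\<dots> = fdet {x \<in> ?D. pd G x \<notin> ?D} (\<lambda>x y. ?M x (?tc y))"
    proof (rule less.hyps)
      show "card ?D < card D" using mD less.prems(1) by (intro card_Diff1_less)
      show "finite ?D" using less.prems(1) by simp
    next
      fix x y assume "x \<in> ?D" "pd G x \<in> ?D" "y \<in> ?D"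
      then show "?M x y = (if y = pd G x then -1 else 0)"
        using less.prems(2)[of x y] less.prems(2)[of x m] mD pd_inj[of x m] by (auto simp: b_def)
    next
      fix x assume "x \<in> ?D" "pd G x \<notin> ?D"
      then have x: "x \<in> D" "pd G x \<notin> D" "x \<noteq> m" using pdm by auto
      obtain k where k: "tc x = (sc G ^^ k) x" "\<forall>j\<le>k. (sc G ^^ j) x \<in> D" and st: "sc G (tc x) \<notin> D"
        using less.prems(3)[OF x(1,2)] by blast
      show "sc G (?tc x) \<notin> ?D \<and> (\<exists>k. ?tc x = (sc G ^^ k) x \<and> (\<forall>j\<le>k. (sc G ^^ j) x \<in> ?D))"
      proof (cases "tc x = m")
        case True
        then obtain k' where k': "k = Suc k'" using k(1) x(3) by (cases k) auto
        have km: "m = sc G ((sc G ^^ k') x)" using True k(1) k' by simp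
        have "(sc G ^^ k') x = b" using km by (simp add: b_def)
        moreover have "(sc G ^^ j) x \<in> ?D" if "j \<le> k'" for j
        proof -
          have "(sc G ^^ j) x \<in> D" "sc G ((sc G ^^ j) x) \<in> D"
            using k(2)[rule_format, of j] k(2)[rule_format, of "Suc j"] that k' by simp_all
          then show ?thesis using pdm[of "sc G ((sc G ^^ j) x)"] by auto
        qed
        ultimately show ?thesis using True b by auto
      next
        case False
        moreover have "(sc G ^^ j) x \<in> ?D" if "j \<le> k" for j
        proof (cases "j = k")
          case True
          then show ?thesis using k False by simp
        next
          case False
          have "(sc G ^^ j) x \<in> D" "sc G ((sc G ^^ j) x) \<in> D"
            using k(2)[rule_format, of j] k(2)[rule_format, of "Suc j"] that False by simp_all
          then show ?thesis using pdm[of "sc G ((sc G ^^ j) x)"] by auto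
        qed
        ultimately show ?thesis using k st by auto
      qed
    qed
    also have "\<dots> = fdet {x \<in> D. pd G x \<notin> D} (\<lambda>x y. M x (tc y))"
      unfolding H
    proof (rule fdet_cong)
      fix x y assume "y \<in> {x \<in> D. pd G x \<notin> D}"
      then have "sc G (tc y) \<notin> D" using less.prems(3)[of y] by auto
      then have "tc y \<noteq> b" using b mD by auto
      then show "?M x (?tc y) = M x (tc y)" by auto
    qed
    finally show ?thesis .
  qed
qed

lemma fdet_strip_matrix:
  assumes "finite D"
    and "\<And>x. x \<in> D \<Longrightarrow> pd G x \<notin> D \<Longrightarrow>
       sc G (tc x) \<notin> D \<and> (\<exists>k. tc x = (sc G ^^ k) x \<and> (\<forall>j\<le>k. (sc G ^^ j) x \<in> D))"
  shows "fdet D (strip_matrix D G R) = fdet {x \<in> D. pd G x \<notin> D} (\<lambda>x y. R (fst x) (fst (tc y)))"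
proof -
  have "fdet D (strip_matrix D G R) = fdet {x \<in> D. pd G x \<notin> D} (\<lambda>x y. strip_matrix D G R x (tc y))"
    by (rule fdet_chain_contraction[OF assms(1) _ assms(2)]) (auto simp: strip_matrix_def)
  also have "\<dots> = fdet {x \<in> D. pd G x \<notin> D} (\<lambda>x y. R (fst x) (fst (tc y)))"
    by (rule fdet_cong) (use assms(2) in \<open>auto simp: strip_matrix_def\<close>)
  finally show ?thesis .
qed

section \<open>Flagged Schur functions of sub-ribbons of the cutting strip\<close>

text \<open>Row and column indices are the bottom and top contents of the columns of the ribbon. A
  column starts one content after the previous one ends, so the subdiagonal entries are
  \<open>E (c + 1) c = 1\<close> and everything below vanishes. Only two entries of the first column
  survive, and they give the two terms of \<open>break_det\<close>.\<close>

lemma det_hessenberg: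
  assumes E: "\<And>p. E p (p - 1) = 1" "\<And>p q. p > q + 1 \<Longrightarrow> E p q = 0"
    and cs: "sorted_wrt (<) cs"
  shows "det (mat (Suc (length cs)) (Suc (length cs))
      (\<lambda>(i, j). E ((p # map (\<lambda>c. c + 1) cs) ! i) ((cs @ [q]) ! j))) = break_det E p cs q"
  using cs
proof (induction cs arbitrary: p)
  case Nil
  show ?case by (simp add: det_single)
next
  case (Cons c cs)
  let ?n = "Suc (length cs)"
  let ?A = "mat (Suc ?n) (Suc ?n)
      (\<lambda>(i, j). E ((p # map (\<lambda>c. c + 1) (c # cs)) ! i) (((c # cs) @ [q]) ! j))"
  have col: "?A $$ (i, 0) = 0" if "i < Suc ?n" "i \<noteq> 0" "i \<noteq> 1" for i
  proof -
    from that(2,3) have "i = Suc (Suc (i - 2))" by simp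
    then obtain k where k: "i = Suc (Suc k)" by blast
    then have "c < cs ! k" using Cons.prems that(1) by simp
    then show ?thesis using k that E(2) by simp
  qed
  have "det ?A = (\<Sum>i<Suc ?n. ?A $$ (i, 0) * cofactor ?A i 0)"
    by (rule laplace_expansion_column) auto
  also have "\<dots> = (\<Sum>i\<in>{0, 1}. ?A $$ (i, 0) * cofactor ?A i 0)"
  proof (rule sum.mono_neutral_right)
    show "\<forall>i\<in>{..<Suc ?n} - {0, 1}. ?A $$ (i, 0) * cofactor ?A i 0 = 0"
    proof
      fix i assume "i \<in> {..<Suc ?n} - {0, 1}"
      then have "?A $$ (i, 0) = 0" by (intro col) auto
      then show "?A $$ (i, 0) * cofactor ?A i 0 = 0" by (simp only: mult_zero_left)
    qed
  qed auto
  also have "\<dots> = E p c * cofactor ?A 0 0 + cofactor ?A 1 0"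
    using E(1)[of "c + 1"] by simp
  also have "cofactor ?A 0 0 = break_det E (c + 1) cs q"
  proof -
    have "mat_delete ?A 0 0 = mat ?n ?n (\<lambda>(i, j). E (((c + 1) # map (\<lambda>c. c + 1) cs) ! i) ((cs @ [q]) ! j))"
      by (rule eq_matI) (auto simp: mat_delete_def)
    then show ?thesis using Cons.IH[of "c + 1"] Cons.prems by (simp add: cofactor_def)
  qed
  \<comment> \<open>Deleting row 1 and column 0 removes the break \<open>c\<close> and fuses the
    first two columns of the ribbon; the odd position supplies the minus sign.\<close>
  also have "cofactor ?A 1 0 = - break_det E p cs q"
  proof -
    have "mat_delete ?A 1 0 = mat ?n ?n (\<lambda>(i, j). E ((p # map (\<lambda>c. c + 1) cs) ! i) ((cs @ [q]) ! j))"
      by (rule eq_matI) (auto simp: mat_delete_def nth_Cons split: nat.splits)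
    then show ?thesis using Cons.IH[of p] Cons.prems by (simp add: cofactor_def)
  qed
  finally show ?case by simp
qed

text \<open>Increasing breaks cut the line into consecutive gaps, and the number of breaks below
  \<open>x\<close> is the number of the gap containing \<open>x\<close>. This locates the column of
  the strip in which a content lies.\<close>

lemma card_less_eq_iff:
  fixes cs :: "int list"
  assumes "sorted_wrt (<) cs" "k \<le> length cs"
  shows "card {c \<in> set cs. c < x} = k \<longleftrightarrow> (k = 0 \<or> cs ! (k - 1) < x) \<and> (k = length cs \<or> x \<le> cs ! k)"
  using assms
proof (induction cs arbitrary: k)
  case (Cons c cs)
  show ?case
  proof (cases "c < x")
    case True
    then have "{d \<in> set (c # cs). d < x} = insert c {d \<in> set cs. d < x}" by auto
    moreover have "c \<notin> set cs" using Cons.prems by auto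
    ultimately have *: "card {d \<in> set (c # cs). d < x} = Suc (card {d \<in> set cs. d < x})" by simp
    show ?thesis
    proof (cases k)
      case 0
      then show ?thesis using * True by simp
    next
      case (Suc m)
      then show ?thesis using * True Cons.IH[of m] Cons.prems
        by (cases m) (auto simp: nth_Cons')
    qed
  next
    case False
    have "{d \<in> set (c # cs). d < x} = {}" using False Cons.prems by auto
    then have *: "card {d \<in> set (c # cs). d < x} = 0" by (simp only: card.empty)
    show ?thesis
    proof (cases k)
      case 0
      then show ?thesis using * False by simp
    next
      case (Suc m)
      have "(c # cs) ! m \<in> set (c # cs)" using Cons.prems Suc by (intro nth_mem) simp
      then have "\<not> (c # cs) ! m < x" using False Cons.prems(1) by auto
      then show ?thesis unfolding * using Suc by simp
    qed
  qed
qed simp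

section \<open>Coordinates of the strip cells and the conjugate parts of the strip\<close>

lemma step_count_hits:
  fixes m0 n :: nat
  assumes "m0 \<le> n" and "card {m'. m' < m0 \<and> P m'} \<le> u" and "u \<le> card {m'. m' < n \<and> P m'}"
  shows "\<exists>m. m0 \<le> m \<and> m \<le> n \<and> card {m'. m' < m \<and> P m'} = u"
  using assms
proof (induction n rule: dec_induct)
  case base
  then show ?case by auto
next
  case (step n)
  show ?case
  proof (cases "u \<le> card {m'. m' < n \<and> P m'}")
    case True
    then obtain m where "m0 \<le> m" "m \<le> n" "card {m'. m' < m \<and> P m'} = u"
      using step by blast
    then show ?thesis by (intro exI[of _ m]) simp
  next
    case False
    have "{m'. m' < Suc n \<and> P m'} \<subseteq> insert n {m'. m' < n \<and> P m'}" by (auto simp: less_Suc_eq)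
    then have "card {m'. m' < Suc n \<and> P m'} \<le> card (insert n {m'. m' < n \<and> P m'})"
      by (intro card_mono) auto
    then have "card {m'. m' < Suc n \<and> P m'} \<le> Suc (card {m'. m' < n \<and> P m'})"
      by simp
    then have "card {m'. m' < Suc n \<and> P m'} = u" using False step.prems by linarith
    then show ?thesis using step.hyps by (intro exI[of _ "Suc n"]) simp
  qed
qed

lemma step_count_mono: "m \<le> n \<Longrightarrow> card {m'::nat. m' < m \<and> P m'} \<le> card {m'. m' < n \<and> P m'}"
  by (intro card_mono) auto

lemma relpos_eq: "relpos up p m =
   (- int (card {m'. m' < m \<and> up (p + int m')}), int (card {m'. m' < m \<and> \<not> up (p + int m')}))"
proof (induction m)
  case (Suc m)
  have *: "{m'. m' < Suc m \<and> Q m'} = (if Q m then insert m {m'. m' < m \<and> Q m'} else {m'. m' < m \<and> Q m'})"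
    for Q by (auto simp: less_Suc_eq)
  show ?case using Suc by (simp add: *)
qed simp

lemma card_up_plus_card_not_up:
  "card {m'::nat. m' < m \<and> P m'} + card {m'. m' < m \<and> \<not> P m'} = m"
proof -
  have "card ({m'. m' < m \<and> P m'} \<union> {m'. m' < m \<and> \<not> P m'}) =
     card {m'. m' < m \<and> P m'} + card {m'. m' < m \<and> \<not> P m'}"
    by (rule card_Un_disjoint) auto
  moreover have "{m'. m' < m \<and> P m'} \<union> {m'. m' < m \<and> \<not> P m'} = {..<m}" by auto
  ultimately show ?thesis by simp
qed

text \<open>With \<open>rights\<close>, the coordinates of the cell of content \<open>p + m\<close>
  relative to the first cell of the strip.\<close>

definition ups :: "(int \<Rightarrow> bool) \<Rightarrow> int \<Rightarrow> nat \<Rightarrow> nat" where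
  "ups up p m = card {m'. m' < m \<and> up (p + int m')}"

definition rights :: "(int \<Rightarrow> bool) \<Rightarrow> int \<Rightarrow> nat \<Rightarrow> nat" where
  "rights up p m = card {m'. m' < m \<and> \<not> up (p + int m')}"

lemma ups_plus_rights: "ups up p m + rights up p m = m"
  unfolding ups_def rights_def by (rule card_up_plus_card_not_up)

lemma ups_mono: "m \<le> n \<Longrightarrow> ups up p m \<le> ups up p n"
  unfolding ups_def by (rule step_count_mono)

lemma rights_mono: "m \<le> n \<Longrightarrow> rights up p m \<le> rights up p n"
  unfolding rights_def by (rule step_count_mono)

text \<open>A discrete intermediate value property: a step climbs at most one row, so no row is
  skipped.\<close>

lemma ups_hits: "m0 \<le> n \<Longrightarrow> ups up p m0 \<le> u \<Longrightarrow> u \<le> ups up p n \<Longrightarrow>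
    \<exists>m. m0 \<le> m \<and> m \<le> n \<and> ups up p m = u"
  unfolding ups_def by (rule step_count_hits)

lemma ups_0 [simp]: "ups up p 0 = 0" and rights_0 [simp]: "rights up p 0 = 0"
  by (simp_all add: ups_def rights_def)

lemma strip_rows_eq: "strip_rows up p q = Suc (ups up p (nat (q - p)))"
  by (simp add: strip_rows_def ups_def)

lemma strip_cols_eq: "strip_cols up p q = Suc (rights up p (nat (q - p)))"
  by (simp add: strip_cols_def rights_def)

lemma strip_cells_iff: "(i, j) \<in> strip_cells up p q \<longleftrightarrow>
   (\<exists>m \<le> nat (q - p). i = int (strip_rows up p q) - int (ups up p m) \<and> j = int (rights up p m) + 1)"
  by (auto simp: strip_cells_def relpos_eq ups_def rights_def image_iff)

lemma finite_strip_cells: "finite (strip_cells up p q)"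
  by (simp add: strip_cells_def)

lemma finite_strip_row: "finite {j. (i, j) \<in> strip_cells up p q}"
  by (rule finite_subset[of _ "snd ` strip_cells up p q"]) (auto simp: finite_strip_cells image_iff Bex_def)

lemma finite_strip_col: "finite {i. (i, j) \<in> strip_cells up p q}"
  by (rule finite_subset[of _ "fst ` strip_cells up p q"]) (auto simp: finite_strip_cells image_iff Bex_def)

lemma strip_row_nonempty:
  assumes "1 \<le> i" "i \<le> strip_rows up p q"
  shows "{j. (int i, j) \<in> strip_cells up p q} \<noteq> {}"
proof -
  obtain m where "m \<le> nat (q - p)" "ups up p m = strip_rows up p q - i"
    using ups_hits[of 0 "nat (q - p)" up p "strip_rows up p q - i"] assms strip_rows_eq[of up p q]
    by fastforce
  then have "(int i, int (rights up p m) + 1) \<in> strip_cells up p q"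
    using assms unfolding strip_cells_iff by (intro exI[of _ m]) auto
  then show ?thesis by blast
qed

lemma conjp_strip_lam:
  assumes "1 \<le> k"
  shows "conjp (strip_lam up p q) k =
    int (card {i. 1 \<le> i \<and> i \<le> strip_rows up p q \<and> (\<exists>j\<ge>k. (int i, j) \<in> strip_cells up p q)})"
proof -
  let ?M = "\<lambda>i. Max {j. (int i, j) \<in> strip_cells up p q}" and ?R = "strip_rows up p q"
  \<comment> \<open>Truncation by \<open>nat\<close> does no harm, as \<open>k\<close> is at least
    1.\<close>
  have *: "k \<le> int (nat (?M i)) \<longleftrightarrow> (\<exists>j\<ge>k. (int i, j) \<in> strip_cells up p q)" if "1 \<le> i" "i \<le> ?R" for i
  proof -
    have "k \<le> int (nat (?M i)) \<longleftrightarrow> k \<le> ?M i" using assms by linarith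
    also have "\<dots> \<longleftrightarrow> (\<exists>j\<in>{j. (int i, j) \<in> strip_cells up p q}. k \<le> j)"
      by (rule Max_ge_iff[OF finite_strip_row strip_row_nonempty[OF that]])
    finally show ?thesis by auto
  qed
  have "conjp (strip_lam up p q) k = int (length (filter (\<lambda>i. k \<le> int (nat (?M i))) [1..<?R + 1]))"
    by (simp add: conjp_def strip_lam_def filter_map o_def)
  also have "length (filter (\<lambda>i. k \<le> int (nat (?M i))) [1..<?R + 1]) =
     card ({i. k \<le> int (nat (?M i))} \<inter> set [1..<?R + 1])"
    by (rule distinct_length_filter) simp
  also have "{i. k \<le> int (nat (?M i))} \<inter> set [1..<?R + 1] =
     {i. 1 \<le> i \<and> i \<le> ?R \<and> (\<exists>j\<ge>k. (int i, j) \<in> strip_cells up p q)}"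
    using * by (auto simp del: int_nat_eq)
  finally show ?thesis .
qed

lemma conjp_strip_mu:
  assumes "1 \<le> k"
  shows "conjp (strip_mu up p q) k =
    int (card {i. 1 \<le> i \<and> i \<le> strip_rows up p q \<and> (\<forall>j. (int i, j) \<in> strip_cells up p q \<longrightarrow> k < j)})"
proof -
  let ?M = "\<lambda>i. Min {j. (int i, j) \<in> strip_cells up p q}" and ?R = "strip_rows up p q"
  have *: "k \<le> int (nat (?M i - 1)) \<longleftrightarrow> (\<forall>j. (int i, j) \<in> strip_cells up p q \<longrightarrow> k < j)"
    if "1 \<le> i" "i \<le> ?R" for i
  proof -
    have "k \<le> int (nat (?M i - 1)) \<longleftrightarrow> k + 1 \<le> ?M i" using assms by linarith
    also have "\<dots> \<longleftrightarrow> (\<forall>j\<in>{j. (int i, j) \<in> strip_cells up p q}. k + 1 \<le> j)"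
      by (rule Min_ge_iff[OF finite_strip_row strip_row_nonempty[OF that]])
    finally show ?thesis by (simp add: add1_zle_eq)
  qed
  have "conjp (strip_mu up p q) k = int (length (filter (\<lambda>i. k \<le> int (nat (?M i - 1))) [1..<?R + 1]))"
    by (simp add: conjp_def strip_mu_def filter_map o_def)
  also have "length (filter (\<lambda>i. k \<le> int (nat (?M i - 1))) [1..<?R + 1]) =
     card ({i. k \<le> int (nat (?M i - 1))} \<inter> set [1..<?R + 1])"
    by (rule distinct_length_filter) simp
  also have "{i. k \<le> int (nat (?M i - 1))} \<inter> set [1..<?R + 1] =
     {i. 1 \<le> i \<and> i \<le> ?R \<and> (\<forall>j. (int i, j) \<in> strip_cells up p q \<longrightarrow> k < j)}"
    using * by (auto simp del: int_nat_eq)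
  finally show ?thesis .
qed

text \<open>Steps \<open>m0\<close> to \<open>m1\<close> run through the column preceded by
  \<open>k\<close> right steps. Since the strip only climbs and moves right, the rows that reach
  this column or go beyond it are those from its bottom cell upwards, and the rows entirely to its
  right are those strictly above its top cell.\<close>

lemma strip_column:
  assumes m: "m0 \<le> m1" "m1 \<le> nat (q - p)"
    and k: "\<And>m. m \<le> nat (q - p) \<Longrightarrow> rights up p m = k \<longleftrightarrow> m0 \<le> m \<and> m \<le> m1"
  shows "conjp (strip_lam up p q) (int k + 1) = int (strip_rows up p q) - int (ups up p m0)"
    and "conjp (strip_mu up p q) (int k + 1) = int (strip_rows up p q) - int (ups up p m1) - 1"
    and "strip_col_bottom up p q (int k + 1) = (int (strip_rows up p q) - int (ups up p m0), int k + 1)"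
    and "strip_col_top up p q (int k + 1) = (int (strip_rows up p q) - int (ups up p m1), int k + 1)"
proof -
  let ?R = "strip_rows up p q" and ?N = "nat (q - p)"
  have R: "?R = Suc (ups up p ?N)" by (rule strip_rows_eq)
  have r0: "rights up p m0 = k" and r1: "rights up p m1 = k" using k[of m0] k[of m1] m by auto
  have ge: "m0 \<le> m" if "k \<le> rights up p m" "m \<le> ?N" for m
  proof (rule ccontr)
    assume "\<not> m0 \<le> m"
    then have "rights up p m \<le> rights up p m0" "rights up p m \<noteq> k"
      using rights_mono[of m m0 up p] k[OF that(2)] by auto
    then show False using that r0 by simp
  qed
  have gt: "k < rights up p m" if "m1 < m" "m \<le> ?N" for m
    using rights_mono[of m1 m up p] k[OF that(2)] that r1 by auto
  have le: "ups up p m0 \<le> ups up p ?N" "ups up p m1 \<le> ups up p ?N" using m by (auto intro: ups_mono)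
  have "{i. 1 \<le> i \<and> i \<le> ?R \<and> (\<exists>j\<ge>int k + 1. (int i, j) \<in> strip_cells up p q)} = {1..?R - ups up p m0}"
  proof (intro Set.set_eqI iffI)
    fix i assume "i \<in> {i. 1 \<le> i \<and> i \<le> ?R \<and> (\<exists>j\<ge>int k + 1. (int i, j) \<in> strip_cells up p q)}"
    then obtain m where i: "1 \<le> i" "m \<le> ?N" "int i = int ?R - int (ups up p m)" "k \<le> rights up p m"
      by (auto simp: strip_cells_iff)
    then have "ups up p m0 \<le> ups up p m" using ge by (intro ups_mono) auto
    then show "i \<in> {1..?R - ups up p m0}" using i by auto
  next
    fix i assume i: "i \<in> {1..?R - ups up p m0}"
    then have "ups up p m0 \<le> ?R - i" "?R - i \<le> ups up p ?N" using R le by auto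
    then obtain m where mm: "m0 \<le> m" "m \<le> ?N" "ups up p m = ?R - i"
      using ups_hits[of m0 ?N up p "?R - i"] m by fastforce
    then have "k \<le> rights up p m" using rights_mono[of m0 m up p] r0 by simp
    moreover have "(int i, int (rights up p m) + 1) \<in> strip_cells up p q"
      unfolding strip_cells_iff using mm i by (intro exI[of _ m]) auto
    ultimately show "i \<in> {i. 1 \<le> i \<and> i \<le> ?R \<and> (\<exists>j\<ge>int k + 1. (int i, j) \<in> strip_cells up p q)}"
      using i by (auto intro!: exI[of _ "int (rights up p m) + 1"])
  qed
  then show "conjp (strip_lam up p q) (int k + 1) = int ?R - int (ups up p m0)"
    using conjp_strip_lam[of "int k + 1" up p q] R le by simp
  have "{i. 1 \<le> i \<and> i \<le> ?R \<and> (\<forall>j. (int i, j) \<in> strip_cells up p q \<longrightarrow> int k + 1 < j)} =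
      {1..?R - ups up p m1 - 1}"
  proof (intro Set.set_eqI iffI)
    fix i assume i: "i \<in> {i. 1 \<le> i \<and> i \<le> ?R \<and> (\<forall>j. (int i, j) \<in> strip_cells up p q \<longrightarrow> int k + 1 < j)}"
    show "i \<in> {1..?R - ups up p m1 - 1}"
    proof (rule ccontr)
      assume "i \<notin> {1..?R - ups up p m1 - 1}"
      then have "?R - i \<le> ups up p m1" using i by auto
      then obtain m where mm: "m \<le> m1" "ups up p m = ?R - i"
        using ups_hits[of 0 m1 up p "?R - i"] by fastforce
      then have "rights up p m \<le> k" using rights_mono[of m m1 up p] r1 by simp
      moreover have "(int i, int (rights up p m) + 1) \<in> strip_cells up p q"
        unfolding strip_cells_iff using mm i m by (intro exI[of _ m]) auto
      then have "int k + 1 < int (rights up p m) + 1" using i by blast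
      then show False using \<open>rights up p m \<le> k\<close> by simp
    qed
  next
    fix i assume i: "i \<in> {1..?R - ups up p m1 - 1}"
    have "int k + 1 < j" if j: "(int i, j) \<in> strip_cells up p q" for j
    proof -
      obtain m where mm: "m \<le> ?N" "int i = int ?R - int (ups up p m)" "j = int (rights up p m) + 1"
        using j unfolding strip_cells_iff by blast
      have "ups up p m1 < ups up p m" using mm(2) i by auto
      then have "\<not> m \<le> m1" using ups_mono[of m m1 up p] by linarith
      then show ?thesis using gt[of m] mm by simp
    qed
    then show "i \<in> {i. 1 \<le> i \<and> i \<le> ?R \<and> (\<forall>j. (int i, j) \<in> strip_cells up p q \<longrightarrow> int k + 1 < j)}"
      using i by auto
  qed
  then show "conjp (strip_mu up p q) (int k + 1) = int ?R - int (ups up p m1) - 1"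
    using conjp_strip_mu[of "int k + 1" up p q] R le by simp
  have col: "(i, int k + 1) \<in> strip_cells up p q \<longleftrightarrow> (\<exists>m. m0 \<le> m \<and> m \<le> m1 \<and> i = int ?R - int (ups up p m))" for i
  proof -
    have "(\<exists>m\<le>?N. i = int ?R - int (ups up p m) \<and> int k + 1 = int (rights up p m) + 1) \<longleftrightarrow>
        (\<exists>m\<le>?N. i = int ?R - int (ups up p m) \<and> m0 \<le> m \<and> m \<le> m1)"
      by (rule ex_cong1) (use k in auto)
    then show ?thesis unfolding strip_cells_iff using m(2) order_trans by blast
  qed
  have mono: "int ?R - int (ups up p m1) \<le> int ?R - int (ups up p m)"
    "int ?R - int (ups up p m) \<le> int ?R - int (ups up p m0)" if "m0 \<le> m" "m \<le> m1" for m
    using ups_mono[OF that(1), of up p] ups_mono[OF that(2), of up p] by simp_all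
  have "Max {i. (i, int k + 1) \<in> strip_cells up p q} = int ?R - int (ups up p m0)"
    by (rule Max_eqI[OF finite_strip_col]) (use m(1) mono(2) in \<open>auto simp: col\<close>)
  then show "strip_col_bottom up p q (int k + 1) = (int ?R - int (ups up p m0), int k + 1)"
    unfolding strip_col_bottom_def by simp
  have "Min {i. (i, int k + 1) \<in> strip_cells up p q} = int ?R - int (ups up p m1)"
    by (rule Min_eqI[OF finite_strip_col]) (use m(1) mono(1) in \<open>auto simp: col\<close>)
  then show "strip_col_top up p q (int k + 1) = (int ?R - int (ups up p m1), int k + 1)"
    unfolding strip_col_top_def by simp
qed

lemma esuper_0: "esuper 0 xs ws = 1"
proof -
  have "esym xs 0 = 1" by (cases xs) auto
  moreover have "hsym ws 0 = 1" by (induction ws) auto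
  ultimately show ?thesis by (simp add: esuper_def)
qed

lemma esuper_neg: "n < 0 \<Longrightarrow> esuper n xs ws = 0"
  by (simp add: esuper_def)

text \<open>Root content \<open>p\<close> gives the cell reached after \<open>m\<close> steps the
  shifted content \<open>p + m\<close>, which is its content in the large diagram. As the flags are
  functions of content, entry \<open>(i, j)\<close> depends only on the bottom content of column
  \<open>i\<close> and the top content of column \<open>j\<close>.\<close>

lemma flagged_schur_strip:
  fixes p q :: int and up :: "int \<Rightarrow> bool" and y z :: "int \<Rightarrow> 'a::comm_ring_1"
  assumes pq: "p \<le> q"
    and A: "\<And>k. A k = \<alpha> (scontent (strip_lam up p q) p (strip_col_top up p q k))"
    and B: "\<And>k. B k = \<beta> (scontent (strip_lam up p q) p (strip_col_bottom up p q k))"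
  shows "flagged_schur (strip_cols up p q) (strip_lam up p q) (strip_mu up p q) p A B y z =
    ribbon_det (\<lambda>d g. esuper (g - d + 1) (vars y (\<alpha> g) (\<beta> d)) (vars z (\<alpha> g + g) (\<beta> d + d)))
      {c. \<not> up c} p q" (is "_ = ribbon_det ?E _ _ _")
proof -
  define cs where "cs = sorted_list_of_set ({c. \<not> up c} \<inter> {p..<q})"
  have set_cs: "set cs = {c. \<not> up c \<and> p \<le> c \<and> c < q}" by (auto simp: cs_def)
  have cs: "sorted_wrt (<) cs" unfolding cs_def by (rule strict_sorted_list_of_set)
  \<comment> \<open>\<open>?ds\<close> and \<open>?gs\<close> list the contents of the bottom and
    top cells of the columns: a column ends where the strip turns right, or at \<open>q\<close>, and
    the next one begins one content later.\<close>
  let ?N = "nat (q - p)" and ?ds = "p # map (\<lambda>c. c + 1) cs" and ?gs = "cs @ [q]"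
  have rights: "rights up p m = card {c \<in> set cs. c < p + int m}" if "m \<le> ?N" for m
  proof -
    have "(\<lambda>m'. p + int m') ` {m'. m' < m \<and> \<not> up (p + int m')} = {c \<in> set cs. c < p + int m}"
    proof (intro Set.set_eqI iffI)
      fix c assume "c \<in> {c \<in> set cs. c < p + int m}"
      then show "c \<in> (\<lambda>m'. p + int m') ` {m'. m' < m \<and> \<not> up (p + int m')}"
        by (intro image_eqI[of _ _ "nat (c - p)"]) (auto simp: set_cs)
    qed (use that in \<open>auto simp: set_cs\<close>)
    moreover have "card ((\<lambda>m'. p + int m') ` {m'. m' < m \<and> \<not> up (p + int m')}) =
        card {m'. m' < m \<and> \<not> up (p + int m')}"
      by (rule card_image) (auto simp: inj_on_def)
    ultimately show ?thesis unfolding rights_def by simp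
  qed
  have nth_cs: "p \<le> cs ! k" "cs ! k < q" if "k < length cs" for k
    using nth_mem[OF that] by (auto simp: set_cs)
  have "rights up p ?N = card {c \<in> set cs. c < q}" using rights[of ?N] pq by simp
  also have "{c \<in> set cs. c < q} = set cs" by (auto simp: set_cs)
  also have "card (set cs) = length cs" by (simp add: cs_def)
  finally have K: "strip_cols up p q = Suc (length cs)" by (simp add: strip_cols_eq)
  have dg: "p \<le> ?ds ! k" "?ds ! k \<le> ?gs ! k" "?gs ! k \<le> q" if "k \<le> length cs" for k
  proof -
    show "p \<le> ?ds ! k" using that nth_cs(1)[of "k - 1"] by (cases k) auto
    show "?gs ! k \<le> q" using that nth_cs(2)[of k] by (auto simp: nth_append)
    show "?ds ! k \<le> ?gs ! k"
    proof (cases k)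
      case 0
      then show ?thesis using nth_cs(1)[of 0] pq by (auto simp: nth_append)
    next
      case (Suc l)
      have ds: "?ds ! k = cs ! l + 1" using Suc that by simp
      show ?thesis
      proof (cases "k = length cs")
        case True
        then have "?gs ! k = q" "l < length cs" using Suc by (simp_all add: nth_append)
        then show ?thesis using nth_cs(2)[of l] ds by simp
      next
        case False
        then have "cs ! l < cs ! k" using that Suc cs by (auto intro: sorted_wrt_nth_less)
        moreover have "?gs ! k = cs ! k" using that False by (simp add: nth_append)
        ultimately show ?thesis using ds by simp
      qed
    qed
  qed
  have key: "rights up p m = k \<longleftrightarrow> nat (?ds ! k - p) \<le> m \<and> m \<le> nat (?gs ! k - p)"
    if k: "k \<le> length cs" and m: "m \<le> ?N" for k m
  proof -
    have "rights up p m = k \<longleftrightarrow> (k = 0 \<or> cs ! (k - 1) < p + int m) \<and> (k = length cs \<or> p + int m \<le> cs ! k)"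
      unfolding rights[OF m] by (rule card_less_eq_iff[OF cs k])
    also have "(k = 0 \<or> cs ! (k - 1) < p + int m) \<longleftrightarrow> nat (?ds ! k - p) \<le> m"
    proof (cases k)
      case (Suc l)
      then have "?ds ! k = cs ! l + 1" using k by simp
      moreover have "nat (cs ! l + 1 - p) \<le> m \<longleftrightarrow> cs ! l < p + int m" by linarith
      ultimately show ?thesis using Suc by (simp only: diff_Suc_1 nat.distinct simp_thms)
    qed simp
    also have "(k = length cs \<or> p + int m \<le> cs ! k) \<longleftrightarrow> m \<le> nat (?gs ! k - p)"
    proof (cases "k = length cs")
      case True
      then show ?thesis using m by (simp add: nth_append)
    next
      case False
      then have "?gs ! k = cs ! k" "p \<le> cs ! k" using k nth_cs(1)[of k] by (simp_all add: nth_append)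
      moreover have "m \<le> nat (cs ! k - p) \<longleftrightarrow> p + int m \<le> cs ! k" using calculation(2) by linarith
      ultimately show ?thesis using False by (simp only: simp_thms)
    qed
    finally show ?thesis .
  qed
  define R where "R = int (strip_rows up p q)"
  let ?m0 = "\<lambda>k. nat (?ds ! k - p)" and ?m1 = "\<lambda>k. nat (?gs ! k - p)"
  have le: "?m0 k \<le> ?m1 k" "?m1 k \<le> ?N" if "k \<le> length cs" for k
    using dg[OF that] by (auto intro: nat_mono)
  note col = strip_column[OF le key, folded R_def]
  have r0: "rights up p (?m0 k) = k" and r1: "rights up p (?m1 k) = k" if "k \<le> length cs" for k
    using key[OF that, of "?m0 k"] key[OF that, of "?m1 k"] le[OF that] by auto
  \<comment> \<open>A cell of content \<open>d\<close> is reached after \<open>d - p\<close> steps;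
    in the column numbered \<open>k\<close> from 0, exactly \<open>k\<close> of them went right and
    the others went up.\<close>
  have u0: "int (ups up p (?m0 k)) = ?ds ! k - p - int k" and u1: "int (ups up p (?m1 k)) = ?gs ! k - p - int k"
    if "k \<le> length cs" for k
    using ups_plus_rights[of up p "?m0 k"] ups_plus_rights[of up p "?m1 k"] r0[OF that] r1[OF that] dg[OF that]
    by linarith+
  have R1: "conjp (strip_lam up p q) 1 = R"
    using col(1)[of 0] by simp
  have lam: "conjp (strip_lam up p q) (int k + 1) = R - (?ds ! k - p - int k)"
    and mu: "conjp (strip_mu up p q) (int k + 1) = R - (?gs ! k - p - int k) - 1"
    and A': "A (int k + 1) = \<alpha> (?gs ! k)" and B': "B (int k + 1) = \<beta> (?ds ! k)"
    if "k \<le> length cs" for k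
    using that by (simp_all only: col A B u0 u1 scontent_def R1 fst_conv snd_conv) (simp_all add: algebra_simps)
  have "flagged_schur (strip_cols up p q) (strip_lam up p q) (strip_mu up p q) p A B y z =
    det (mat (Suc (length cs)) (Suc (length cs)) (\<lambda>(i, j). ?E (?ds ! i) (?gs ! j)))"
    unfolding flagged_schur_def K
  proof (rule arg_cong[where f = det], rule cong_mat)
    fix i j assume "i < Suc (length cs)" "j < Suc (length cs)"
    then have ij: "i \<le> length cs" "j \<le> length cs" by auto
    have "conj_flag_a (strip_lam up p q) (strip_mu up p q) p A (int j + 1) = \<alpha> (?gs ! j) + ?gs ! j"
      unfolding conj_flag_a_def A'[OF ij(2)] scontent_def R1 fst_conv snd_conv mu[OF ij(2)] by simp
    moreover have "conj_flag_b (strip_lam up p q) p B (int i + 1) = \<beta> (?ds ! i) + ?ds ! i"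
      unfolding conj_flag_b_def B'[OF ij(1)] scontent_def R1 fst_conv snd_conv lam[OF ij(1)] by simp
    moreover have "conjp (strip_lam up p q) (int i + 1) - (int i + 1) - conjp (strip_mu up p q) (int j + 1) + (int j + 1)
        = ?gs ! j - ?ds ! i + 1"
      unfolding lam[OF ij(1)] mu[OF ij(2)] by simp
    ultimately show "(case (i, j) of (i0, j0) \<Rightarrow> let i = int i0 + 1; j = int j0 + 1 in
        esuper (conjp (strip_lam up p q) i - i - conjp (strip_mu up p q) j + j) (vars y (A j) (B i))
          (vars z (conj_flag_a (strip_lam up p q) (strip_mu up p q) p A j) (conj_flag_b (strip_lam up p q) p B i))) =
       (case (i, j) of (i, j) \<Rightarrow> ?E (?ds ! i) (?gs ! j))"
      by (simp only: prod.case Let_def A'[OF ij(2)] B'[OF ij(1)])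
  qed simp_all
  also have "\<dots> = break_det ?E p cs q"
    by (rule det_hessenberg[OF _ _ cs]) (simp_all add: esuper_0 esuper_neg)
  finally show ?thesis unfolding ribbon_det_def cs_def .
qed

section \<open>Skew diagrams and ribbons\<close>

lemma part_nonneg: "0 \<le> part lam i"
  by (simp add: part_def)

lemma part_antimono:
  assumes "is_partition lam" "1 \<le> i" "i \<le> i'"
  shows "part lam i' \<le> part lam i"
proof (cases "i = i' \<or> int (length lam) < i'")
  case True
  then show ?thesis using part_nonneg[of lam i] by (auto simp: part_def)
next
  case False
  then have "nat (i - 1) < nat (i' - 1)" "nat (i' - 1) < length lam" using assms by auto
  then have "lam ! nat (i' - 1) \<le> lam ! nat (i - 1)"
    using assms(1) unfolding is_partition_def by (metis sorted_wrt_nth_less)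
  then show ?thesis using False assms by (simp add: part_def)
qed

lemma skew_iff: "(i, j) \<in> skew lam mu \<longleftrightarrow> 1 \<le> i \<and> part mu i < j \<and> j \<le> part lam i"
  using part_nonneg[of mu i] by (auto simp: skew_def diagram_def)

text \<open>The rows of length at least \<open>j\<close> form an initial segment, so their number is
  at least \<open>i\<close> exactly when row \<open>i\<close> is among them.\<close>

lemma le_conjp_iff:
  assumes lam: "is_partition lam" and "1 \<le> i" "1 \<le> j"
  shows "i \<le> conjp lam j \<longleftrightarrow> j \<le> part lam i"
proof -
  let ?S = "{k. k < length lam \<and> j \<le> int (lam ! k)}"
  have *: "conjp lam j = int (card ?S)" by (simp add: conjp_def length_filter_conv_card)
  have down: "k' \<in> ?S" if "k \<in> ?S" "k' \<le> k" for k k'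
  proof (cases "k' = k")
    case False
    then have "lam ! k \<le> lam ! k'" using that lam unfolding is_partition_def
      by (auto intro: sorted_wrt_nth_less)
    then show ?thesis using that by auto
  qed (use that in auto)
  show ?thesis
  proof
    assume "j \<le> part lam i"
    then have "nat (i - 1) \<in> ?S" using assms by (auto simp: part_def split: if_splits)
    then have "{..nat (i - 1)} \<subseteq> ?S" using down by blast
    then have "card {..nat (i - 1)} \<le> card ?S" by (intro card_mono) auto
    then show "i \<le> conjp lam j" using * assms by simp
  next
    assume i: "i \<le> conjp lam j"
    show "j \<le> part lam i"
    proof (rule ccontr)
      assume "\<not> j \<le> part lam i"
      then have "nat (i - 1) \<notin> ?S" using assms by (auto simp: part_def split: if_splits)
      have "?S \<subseteq> {..<nat (i - 1)}"
      proof
        fix k assume k: "k \<in> ?S"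
        then have "\<not> nat (i - 1) \<le> k" using down[OF k] \<open>nat (i - 1) \<notin> ?S\<close> by blast
        then show "k \<in> {..<nat (i - 1)}" by simp
      qed
      then have "card ?S \<le> card {..<nat (i - 1)}" by (intro card_mono) auto
      then show False using i * assms by simp
    qed
  qed
qed

lemma conjp_nonneg: "0 \<le> conjp lam j"
  by (simp add: conjp_def)

lemma conjp_antimono: "j \<le> j' \<Longrightarrow> conjp lam j' \<le> conjp lam j"
  unfolding conjp_def of_nat_le_iff length_filter_conv_card by (rule card_mono) auto

lemma skew_iff_conjp:
  assumes "is_partition lam" "is_partition mu" "1 \<le> j"
  shows "(i, j) \<in> skew lam mu \<longleftrightarrow> conjp mu j < i \<and> i \<le> conjp lam j"
proof (cases "1 \<le> i")
  case True
  then show ?thesis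
    using le_conjp_iff[OF assms(1) True assms(3)] le_conjp_iff[OF assms(2) True assms(3)]
    by (auto simp: skew_iff)
next
  case False
  then show ?thesis using conjp_nonneg[of mu j] by (auto simp: skew_iff)
qed

lemma finite_skew: "finite (skew lam mu)"
proof (rule finite_subset)
  show "skew lam mu \<subseteq> (SIGMA i : {1..int (length lam)}. {1..part lam i})"
    by (auto simp: skew_def diagram_def part_def split: if_splits)
qed auto

section \<open>Convex cell sets and their corners\<close>

definition convex_cells :: "cell set \<Rightarrow> bool" where
  "convex_cells S \<longleftrightarrow> (\<forall>i j i' j' k l. (i, j) \<in> S \<longrightarrow> (i', j') \<in> S \<longrightarrow>
     i \<le> k \<longrightarrow> k \<le> i' \<longrightarrow> j \<le> l \<longrightarrow> l \<le> j' \<longrightarrow> (k, l) \<in> S)"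

lemma convex_cellsD:
  "convex_cells S \<Longrightarrow> (i, j) \<in> S \<Longrightarrow> (i', j') \<in> S \<Longrightarrow> i \<le> k \<Longrightarrow> k \<le> i' \<Longrightarrow> j \<le> l \<Longrightarrow> l \<le> j' \<Longrightarrow> (k, l) \<in> S"
  unfolding convex_cells_def by blast

lemma convex_skew:
  assumes "is_partition lam" "is_partition mu"
  shows "convex_cells (skew lam mu)"
  unfolding convex_cells_def
proof (intro allI impI)
  fix i j i' j' k l
  assume *: "(i, j) \<in> skew lam mu" "(i', j') \<in> skew lam mu" "i \<le> k" "k \<le> i'" "j \<le> l" "l \<le> j'"
  then have "part lam i' \<le> part lam k" "part mu k \<le> part mu i"
    using part_antimono[OF assms(1), of k i'] part_antimono[OF assms(2), of i k] by (auto simp: skew_iff)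
  then show "(k, l) \<in> skew lam mu" using * by (auto simp: skew_iff)
qed

text \<open>The definition looks at the last column first, yet the corner is extremal in both
  coordinates: a higher cell further left would, by convexity, force a higher cell in the last
  column.\<close>

lemma corner_top_right:
  assumes "finite S" "S \<noteq> {}" "convex_cells S"
  shows "top_right S \<in> S" "\<And>d. d \<in> S \<Longrightarrow> fst (top_right S) \<le> fst d \<and> snd d \<le> snd (top_right S)"
proof -
  define j where "j = Max (snd ` S)"
  define i where "i = Min {i. (i, j) \<in> S}"
  have j: "\<And>d. d \<in> S \<Longrightarrow> snd d \<le> j" using assms(1) by (simp add: j_def)
  have "j \<in> snd ` S" unfolding j_def using assms by simp
  then have ne: "{i. (i, j) \<in> S} \<noteq> {}" by force
  have fin: "finite {i. (i, j) \<in> S}"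
    by (rule finite_subset[of _ "fst ` S"]) (use assms(1) in \<open>auto simp: image_iff Bex_def\<close>)
  have ij: "(i, j) \<in> S" using Min_in[OF fin ne] by (simp add: i_def)
  have i: "i \<le> i'" if "(i', j) \<in> S" for i' using Min_le[OF fin] that by (simp add: i_def)
  have eq: "top_right S = (i, j)"
    unfolding top_right_def
  proof (rule the_equality)
    show "(i, j) \<in> S \<and> (\<forall>d\<in>S. snd d \<le> snd (i, j)) \<and> (\<forall>d\<in>S. snd d = snd (i, j) \<longrightarrow> fst (i, j) \<le> fst d)"
      using ij i j by auto
    fix c assume c: "c \<in> S \<and> (\<forall>d\<in>S. snd d \<le> snd c) \<and> (\<forall>d\<in>S. snd d = snd c \<longrightarrow> fst c \<le> fst d)"
    have "snd c \<le> j" using c j by blast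
    moreover have "j \<le> snd c" using bspec[OF conjunct1[OF conjunct2[OF c]] ij] by simp
    ultimately have cj: "snd c = j" by simp
    then have "(fst c, j) \<in> S" using c by (metis prod.collapse)
    then have "i \<le> fst c" by (rule i)
    moreover have "fst c \<le> i" using bspec[OF conjunct2[OF conjunct2[OF c]] ij] cj by simp
    ultimately show "c = (i, j)" using cj by (simp add: prod_eq_iff)
  qed
  show "top_right S \<in> S" using ij eq by simp
  fix d assume d: "d \<in> S"
  have "i \<le> fst d"
  proof (rule ccontr)
    assume "\<not> i \<le> fst d"
    moreover have "(fst d, snd d) \<in> S" using d by simp
    ultimately have "(fst d, j) \<in> S"
      using convex_cellsD[OF assms(3), of "fst d" "snd d" i j "fst d" j] ij j[OF d] by simp
    then show False using i \<open>\<not> i \<le> fst d\<close> by blast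
  qed
  then show "fst (top_right S) \<le> fst d \<and> snd d \<le> snd (top_right S)" using j[OF d] eq by simp
qed

lemma corner_bottom_left:
  assumes "finite S" "S \<noteq> {}" "convex_cells S"
  shows "bottom_left S \<in> S" "\<And>d. d \<in> S \<Longrightarrow> fst d \<le> fst (bottom_left S) \<and> snd (bottom_left S) \<le> snd d"
proof -
  define j where "j = Min (snd ` S)"
  define i where "i = Max {i. (i, j) \<in> S}"
  have j: "\<And>d. d \<in> S \<Longrightarrow> j \<le> snd d" using assms(1) by (simp add: j_def)
  have "j \<in> snd ` S" unfolding j_def using assms by simp
  then have ne: "{i. (i, j) \<in> S} \<noteq> {}" by force
  have fin: "finite {i. (i, j) \<in> S}"
    by (rule finite_subset[of _ "fst ` S"]) (use assms(1) in \<open>auto simp: image_iff Bex_def\<close>)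
  have ij: "(i, j) \<in> S" using Max_in[OF fin ne] by (simp add: i_def)
  have i: "i' \<le> i" if "(i', j) \<in> S" for i' using Max_ge[OF fin] that by (simp add: i_def)
  have eq: "bottom_left S = (i, j)"
    unfolding bottom_left_def
  proof (rule the_equality)
    show "(i, j) \<in> S \<and> (\<forall>d\<in>S. snd (i, j) \<le> snd d) \<and> (\<forall>d\<in>S. snd d = snd (i, j) \<longrightarrow> fst d \<le> fst (i, j))"
      using ij i j by auto
    fix c assume c: "c \<in> S \<and> (\<forall>d\<in>S. snd c \<le> snd d) \<and> (\<forall>d\<in>S. snd d = snd c \<longrightarrow> fst d \<le> fst c)"
    have "j \<le> snd c" using c j by blast
    moreover have "snd c \<le> j" using bspec[OF conjunct1[OF conjunct2[OF c]] ij] by simp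
    ultimately have cj: "snd c = j" by simp
    then have "(fst c, j) \<in> S" using c by (metis prod.collapse)
    then have "fst c \<le> i" by (rule i)
    moreover have "i \<le> fst c" using bspec[OF conjunct2[OF conjunct2[OF c]] ij] cj by simp
    ultimately show "c = (i, j)" using cj by (simp add: prod_eq_iff)
  qed
  show "bottom_left S \<in> S" using ij eq by simp
  fix d assume d: "d \<in> S"
  have "fst d \<le> i"
  proof (rule ccontr)
    assume "\<not> fst d \<le> i"
    moreover have "(fst d, snd d) \<in> S" using d by simp
    ultimately have "(fst d, j) \<in> S"
      using convex_cellsD[OF assms(3), of i j "fst d" "snd d" "fst d" j] ij j[OF d] by simp
    then show False using i \<open>\<not> fst d \<le> i\<close> by blast
  qed
  then show "fst d \<le> fst (bottom_left S) \<and> snd (bottom_left S) \<le> snd d" using j[OF d] eq by simp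
qed

section \<open>Contents and steps along a ribbon\<close>

definition ct :: "cell \<Rightarrow> int" where "ct x = snd x - fst x"

definition cell_up :: "cell \<Rightarrow> cell" where "cell_up x = (fst x - 1, snd x)"
definition cell_right :: "cell \<Rightarrow> cell" where "cell_right x = (fst x, snd x + 1)"

lemma ct_up [simp]: "ct (cell_up x) = ct x + 1" and ct_right [simp]: "ct (cell_right x) = ct x + 1"
  by (simp_all add: ct_def cell_up_def cell_right_def)

text \<open>Adjacent cells differ in content by one, so a path from content at most \<open>c\<close>
  to content above \<open>c\<close> must somewhere step from \<open>c\<close> to
  \<open>c + 1\<close>, that is, up or right.\<close>

lemma content_crossing:
  assumes "edge_connected S" "x \<in> S" "y \<in> S" "ct x \<le> c" "c < ct y"
  shows "\<exists>u\<in>S. ct u = c \<and> (cell_up u \<in> S \<or> cell_right u \<in> S)"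
proof -
  have "(x, y) \<in> {(u, v). u \<in> S \<and> v \<in> S \<and> adjacent u v}\<^sup>*"
    using assms by (auto simp: edge_connected_def)
  then show ?thesis using assms(4,5)
  proof (induction rule: converse_rtrancl_induct)
    case base
    then show ?case by simp
  next
    case (step x w)
    show ?case
    proof (cases "ct w \<le> c")
      case True
      then show ?thesis using step by blast
    next
      case False
      have w: "w \<in> S" "x \<in> S" "\<bar>fst x - fst w\<bar> + \<bar>snd x - snd w\<bar> = 1"
        using step.hyps(1) by (auto simp: adjacent_def)
      then have "ct x = c" "w = cell_up x \<or> w = cell_right x"
        using False step.prems(1) by (auto simp: ct_def cell_up_def cell_right_def prod_eq_iff)
      then show ?thesis using w by blast
    qed
  qed
qed

lemma ribbon_convex:
  assumes "is_ribbon S"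
  shows "convex_cells S" "finite S" "S \<noteq> {}" "edge_connected S"
  using assms convex_skew finite_skew by (auto simp: is_ribbon_def is_skew_diagram_def)

text \<open>By convexity, two cells on one diagonal would enclose a 2 by 2 block.\<close>

lemma ribbon_content_inj:
  assumes S: "is_ribbon S" and "x \<in> S" "y \<in> S" "ct x = ct y"
  shows "x = y"
proof -
  have *: False if "(i, j) \<in> S" "(i + k, j + k) \<in> S" "0 < k" for i j k
  proof -
    have "(i, j) \<in> S \<and> (i + 1, j) \<in> S \<and> (i, j + 1) \<in> S \<and> (i + 1, j + 1) \<in> S"
      using convex_cellsD[OF ribbon_convex(1)[OF S] that(1,2)] that(3) by simp
    then show False using S unfolding is_ribbon_def by blast
  qed
  define k where "k = fst y - fst x"
  have x: "x = (fst x, snd x)" and y: "y = (fst x + k, snd x + k)"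
    using assms(4) by (auto simp: k_def ct_def prod_eq_iff)
  have "\<not> 0 < k" using *[of "fst x" "snd x" k] assms(2,3) y by auto
  moreover have "\<not> 0 < - k" using *[of "fst x + k" "snd x + k" "- k"] assms(2,3) y by auto
  ultimately show ?thesis using y by (simp add: prod_eq_iff)
qed

text \<open>The crossing edge at the content of \<open>x\<close> must start at \<open>x\<close>
  itself, the only cell of the ribbon with that content.\<close>

lemma ribbon_successor:
  assumes S: "is_ribbon S" and "x \<in> S" "y \<in> S" "ct x < ct y"
  shows "cell_up x \<in> S \<or> cell_right x \<in> S"
proof -
  obtain u where u: "u \<in> S" "ct u = ct x" "cell_up u \<in> S \<or> cell_right u \<in> S"
    using content_crossing[OF ribbon_convex(4)[OF S] assms(2,3), of "ct x"] assms(4) by auto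
  then show ?thesis using ribbon_content_inj[OF S u(1) assms(2)] by simp
qed

lemma ribbon_predecessor:
  assumes S: "is_ribbon S" and "x \<in> S" "y \<in> S" "ct y < ct x"
  shows "\<exists>u\<in>S. cell_up u = x \<or> cell_right u = x"
proof -
  obtain u where u: "u \<in> S" "ct u = ct x - 1" "cell_up u \<in> S \<or> cell_right u \<in> S"
    using content_crossing[OF ribbon_convex(4)[OF S] assms(3,2), of "ct x - 1"] assms by auto
  have "cell_up u = x" if "cell_up u \<in> S"
    by (rule ribbon_content_inj[OF S that assms(2)]) (simp add: u(2))
  moreover have "cell_right u = x" if "cell_right u \<in> S"
    by (rule ribbon_content_inj[OF S that assms(2)]) (simp add: u(2))
  ultimately show ?thesis using u(1,3) by blast
qed

lemma ct_top_right:
  assumes "finite S" "S \<noteq> {}" "convex_cells S" "d \<in> S"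
  shows "ct d \<le> ct (top_right S)" "ct d = ct (top_right S) \<Longrightarrow> d = top_right S"
  using corner_top_right(2)[OF assms] by (auto simp: ct_def prod_eq_iff)

lemma ct_bottom_left:
  assumes "finite S" "S \<noteq> {}" "convex_cells S" "d \<in> S"
  shows "ct (bottom_left S) \<le> ct d" "ct d = ct (bottom_left S) \<Longrightarrow> d = bottom_left S"
  using corner_bottom_left(2)[OF assms] by (auto simp: ct_def prod_eq_iff)

text \<open>Pigeonhole: a permutation that moves \<open>a\<close> and has a nonzero product would
  inject the indices \<open>\<ge> a\<close> into those \<open>> a\<close>.\<close>

lemma fdet_remove_block_triangular:
  fixes f :: "int \<Rightarrow> int \<Rightarrow> 'a::comm_ring_1"
  assumes A: "finite A" "a \<in> A" and f: "f a a = 1"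
    and z: "\<And>x y. x \<in> A \<Longrightarrow> y \<in> A \<Longrightarrow> a \<le> x \<Longrightarrow> y \<le> a \<Longrightarrow> \<not> (x = a \<and> y = a) \<Longrightarrow> f x y = 0"
  shows "fdet A f = fdet (A - {a}) f"
proof (rule fdet_remove_fixed_point[where f = f, OF A f])
  fix p assume pA: "p permutes A" and pa: "p a \<noteq> a"
  define U where "U = {x \<in> A. a < x}"
  show "\<exists>x\<in>A. f x (p x) = 0"
  proof (rule ccontr)
    assume nz: "\<not> (\<exists>x\<in>A. f x (p x) = 0)"
    have img: "p ` insert a U \<subseteq> U"
    proof
      fix w assume "w \<in> p ` insert a U"
      then obtain x where x: "x \<in> insert a U" "w = p x" by blast
      then have "x \<in> A" "a \<le> x" using A by (auto simp: U_def)
      moreover have "p x \<in> A" using permutes_in_image[OF pA] \<open>x \<in> A\<close> by simp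
      ultimately have "\<not> p x \<le> a" using z[of x "p x"] nz pa by blast
      then show "w \<in> U" using x \<open>p x \<in> A\<close> by (simp add: U_def)
    qed
    have fin: "finite U" using A by (simp add: U_def)
    have "card (insert a U) = card (p ` insert a U)"
      by (rule card_image[symmetric]) (rule inj_on_subset[OF permutes_inj[OF pA]], simp)
    also have "\<dots> \<le> card U" by (rule card_mono[OF fin img])
    finally show False using fin by (simp add: U_def)
  qed
qed

text \<open>Columns of the diagram may be empty; they make the Jacobi-Trudi matrix block triangular.\<close>

lemma flagged_schur_nonempty_columns:
  "flagged_schur n lam mu r a b y z = fdet {j. 1 \<le> j \<and> j \<le> int n \<and> conjp lam j \<noteq> conjp mu j}
     (\<lambda>i j. esuper (conjp lam i - i - conjp mu j + j)
        (vars y (a j) (b i)) (vars z (conj_flag_a lam mu r a j) (conj_flag_b lam r b i)))"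
  (is "_ = fdet ?J ?f")
proof -
  define Z where "Z = {j. 1 \<le> j \<and> j \<le> int n \<and> conjp lam j = conjp mu j}"
  have "finite Z" by (rule finite_subset[of _ "{1..int n}"]) (auto simp: Z_def)
  have "flagged_schur n lam mu r a b y z = fdet {0..<n} (\<lambda>i j. ?f (int i + 1) (int j + 1))"
    unfolding fdet_mat flagged_schur_def Let_def by simp
  also have "\<dots> = fdet {1..int n} ?f"
  proof (rule fdet_reindex[symmetric])
    show "bij_betw (\<lambda>i. int i + 1) {0..<n} {1..int n}"
      by (rule bij_betw_byWitness[where f' = "\<lambda>j. nat (j - 1)"]) auto
  qed simp
  also have "\<dots> = fdet ({1..int n} - Z) ?f"
  proof -
    have "fdet {1..int n} ?f = fdet ({1..int n} - F) ?f" if "finite F" "F \<subseteq> Z" for F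
      using that
    proof (induction F)
      case empty
      show ?case by simp
    next
      case (insert j F)
      have j: "1 \<le> j" "j \<le> int n" "conjp lam j = conjp mu j" using insert.prems by (auto simp: Z_def)
      have "fdet ({1..int n} - F) ?f = fdet ({1..int n} - F - {j}) ?f"
      proof (rule fdet_remove_block_triangular)
        show "?f j j = 1" using j by (simp add: esuper_0)
        fix x w assume "j \<le> x" "w \<le> j" "\<not> (x = j \<and> w = j)"
        \<comment> \<open>Since column \<open>j\<close> is empty,
          \<open>conjp lam x \<le> conjp lam j = conjp mu j \<le> conjp mu w\<close>; strictness
          comes from \<open>w < x\<close>.\<close>
        then have "conjp lam x - x - conjp mu w + w < 0"
          using conjp_antimono[of j x lam] conjp_antimono[of w j mu] j by linarith
        then show "?f x w = 0" by (rule esuper_neg)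
      qed (use insert.hyps j in auto)
      moreover have "{1..int n} - F - {j} = {1..int n} - insert j F" by auto
      ultimately show ?case using insert.IH insert.prems by simp
    qed
    then show ?thesis using \<open>finite Z\<close> by blast
  qed
  also have "{1..int n} - Z = ?J" by (auto simp: Z_def)
  finally show ?thesis .
qed

section \<open>All cells of one content go in the same direction\<close>

lemma ribbon_unique:
  assumes "outer_ribbon_decomp D Th" "th \<in> set Th" "th' \<in> set Th" "x \<in> th" "x \<in> th'"
  shows "th = th'"
proof -
  obtain i j where "i < length Th" "j < length Th" "th = Th ! i" "th' = Th ! j"
    using assms(2,3) by (metis in_set_conv_nth)
  then show ?thesis using assms unfolding outer_ribbon_decomp_def by (metis disjoint_iff)
qed

lemma goes_up_diagonal_step:
  assumes D: "convex_cells D" "finite D" "D \<noteq> {}" and dec: "outer_ribbon_decomp D Th"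
    and th: "th \<in> set Th" "th' \<in> set Th" and u: "(i, j) \<in> th" and u': "(i + 1, j + 1) \<in> th'"
  shows "goes_up D th (i, j) \<longleftrightarrow> goes_up D th' (i + 1, j + 1)"
proof -
  have rib: "is_ribbon t" "on_left D (bottom_left t) \<or> on_bottom D (bottom_left t)"
    "on_top D (top_right t) \<or> on_right D (top_right t)" "t \<subseteq> D" if "t \<in> set Th" for t
    using dec that unfolding outer_ribbon_decomp_def by blast+
  have uD: "(i, j) \<in> D" "(i + 1, j + 1) \<in> D" using u u' th rib(4) by blast+
  have xD: "(i, j + 1) \<in> D" using convex_cellsD[OF D(1) uD] by simp
  \<comment> \<open>The cell \<open>(i, j + 1)\<close> has larger content than both, so the special
    rule for the top-right cell of the diagram does not apply to either.\<close>
  have ne: "(i, j) \<noteq> top_right D" "(i + 1, j + 1) \<noteq> top_right D"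
  proof -
    have "ct (i, j) < ct (top_right D)" "ct (i + 1, j + 1) < ct (top_right D)"
      using ct_top_right(1)[OF D(2,3,1) xD] by (simp_all add: ct_def)
    then show "(i, j) \<noteq> top_right D" "(i + 1, j + 1) \<noteq> top_right D" by force+
  qed
  obtain t where t: "t \<in> set Th" "(i, j + 1) \<in> t"
    using dec xD unfolding outer_ribbon_decomp_def by blast
  note t_conv = ribbon_convex[OF rib(1)[OF t(1)]]
  \<comment> \<open>\<open>(i, j + 1)\<close> is not a head, so its predecessor \<open>(i, j)\<close> or \<open>(i + 1, j + 1)\<close> shares its ribbon;
    this decides the direction of both.\<close>
  have "(i, j + 1) \<noteq> bottom_left t"
  proof
    assume b: "(i, j + 1) = bottom_left t"
    \<comment> \<open>A head has no neighbour in the diagram to its left or below, but here both are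
      present.\<close>
    show False using rib(2)[OF t(1)] uD unfolding b[symmetric] on_left_def on_bottom_def by simp
  qed
  then have "ct (bottom_left t) < ct (i, j + 1)"
    using ct_bottom_left[OF t_conv(2,3,1) t(2)] by force
  then obtain v where v: "v \<in> t" "cell_up v = (i, j + 1) \<or> cell_right v = (i, j + 1)"
    using ribbon_predecessor[OF rib(1)[OF t(1)] t(2) corner_bottom_left(1)[OF t_conv(2,3,1)]] by blast
  then have "(i + 1, j + 1) \<in> t \<or> (i, j) \<in> t"
    by (cases v) (auto simp: cell_up_def cell_right_def)
  then have "t = th' \<or> t = th" using ribbon_unique[OF dec] th t(1) u u' by blast
  then show ?thesis
  proof
    assume "t = th'"
    then have x: "(i, j + 1) \<in> th'" using t by simp
    have x': "(i, j + 1) \<notin> th"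
    proof
      assume "(i, j + 1) \<in> th"
      then have "th = th'" using ribbon_unique[OF dec th] x by blast
      then have "(i, j) = (i + 1, j + 1)"
        using ribbon_content_inj[OF rib(1)[OF th(1)] u] u' by (simp add: ct_def)
      then show False by simp
    qed
    \<comment> \<open>Here \<open>(i, j + 1)\<close> belongs to the other ribbon. Either
      \<open>(i, j)\<close> continues, necessarily upwards, or it is a tail; as its right neighbour
      is in the diagram, such a tail lies on the top perimeter and also goes up.\<close>
    have "goes_up D th (i, j)"
    proof (cases "(i, j) = top_right th")
      case True
      then show ?thesis using rib(3)[OF th(1)] xD ne(1)
        unfolding goes_up_def True[symmetric] on_right_def by simp
    next
      case False
      note th_conv = ribbon_convex[OF rib(1)[OF th(1)]]
      have "ct (i, j) < ct (top_right th)" using ct_top_right[OF th_conv(2,3,1) u] False by force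
      then have "cell_up (i, j) \<in> th"
        using ribbon_successor[OF rib(1)[OF th(1)] u corner_top_right(1)[OF th_conv(2,3,1)]] x'
        by (simp add: cell_right_def)
      then show ?thesis using ne by (simp add: goes_up_def cell_up_def)
    qed
    moreover have "goes_up D th' (i + 1, j + 1)" using x ne by (simp add: goes_up_def)
    ultimately show ?thesis by simp
  next
    assume "t = th"
    then have x: "(i, j + 1) \<in> th" using t by simp
    have x': "(i, j + 1) \<notin> th'"
    proof
      assume "(i, j + 1) \<in> th'"
      then have "th = th'" using ribbon_unique[OF dec th] x by blast
      then have "(i, j) = (i + 1, j + 1)"
        using ribbon_content_inj[OF rib(1)[OF th(1)] u] u' by (simp add: ct_def)
      then show False by simp
    qed
    note th_conv = ribbon_convex[OF rib(1)[OF th(1)]]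
    have "(i - 1, j) \<notin> th"
    proof
      assume "(i - 1, j) \<in> th"
      then have "(i - 1, j) = (i, j + 1)"
        using ribbon_content_inj[OF rib(1)[OF th(1)] _ x] by (simp add: ct_def)
      then show False by simp
    qed
    moreover have "(i, j) \<noteq> top_right th"
    proof -
      have "ct (i, j) < ct (top_right th)"
        using ct_top_right(1)[OF th_conv(2,3,1) x] by (simp add: ct_def)
      then show ?thesis by force
    qed
    ultimately have "\<not> goes_up D th (i, j)" using ne by (simp add: goes_up_def)
    \<comment> \<open>The cell above \<open>(i + 1, j + 1)\<close> is in the diagram but in another
      ribbon, so this cell neither continues upwards nor is a tail on the top perimeter.\<close>
    moreover have "\<not> goes_up D th' (i + 1, j + 1)" using x' xD ne by (simp add: goes_up_def on_top_def)
    ultimately show ?thesis by simp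
  qed
qed

text \<open>\<open>content_up\<close> asks for a single witness; this transfers its direction to
  every cell of that content. Convexity puts all cells in between into the diagram, hence into
  ribbons, so diagonal steps compose.\<close>

lemma goes_up_diagonal:
  assumes D: "convex_cells D" "finite D" "D \<noteq> {}" and dec: "outer_ribbon_decomp D Th"
    and th: "th \<in> set Th" "th' \<in> set Th" and u: "u \<in> th" and u': "u' \<in> th'" and ct: "ct u = ct u'"
    and up: "goes_up D th u"
  shows "goes_up D th' u'"
proof -
  have cov: "\<Union>(set Th) = D" using dec by (simp add: outer_ribbon_decomp_def)
  have *: "goes_up D s (i, j) \<longleftrightarrow> goes_up D s' (i + int k, j + int k)"
    if "s \<in> set Th" "s' \<in> set Th" "(i, j) \<in> s" "(i + int k, j + int k) \<in> s'" for s s' i j k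
    using that
  proof (induction k arbitrary: s')
    case 0
    then have "s = s'" using ribbon_unique[OF dec] by auto
    then show ?case by simp
  next
    case (Suc k)
    have "(i, j) \<in> D" "(i + int (Suc k), j + int (Suc k)) \<in> D" using Suc.prems cov by blast+
    then have "(i + int k, j + int k) \<in> D" by (rule convex_cellsD[OF D(1)]) auto
    then obtain t where t: "t \<in> set Th" "(i + int k, j + int k) \<in> t" using cov by blast
    have "goes_up D s (i, j) \<longleftrightarrow> goes_up D t (i + int k, j + int k)"
      using Suc.IH[of t] Suc.prems t by blast
    also have "\<dots> \<longleftrightarrow> goes_up D s' (i + int k + 1, j + int k + 1)"
      by (rule goes_up_diagonal_step[OF D dec t(1) Suc.prems(2) t(2)])
         (use Suc.prems(4) in \<open>simp add: algebra_simps\<close>)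
    finally show ?case by (simp add: algebra_simps)
  qed
  show ?thesis
  proof (cases "fst u \<le> fst u'")
    case True
    have "u = (fst u, snd u)" "u' = (fst u + int (nat (fst u' - fst u)), snd u + int (nat (fst u' - fst u)))"
      using True ct by (auto simp: ct_def prod_eq_iff)
    then show ?thesis using *[OF th, of "fst u" "snd u" "nat (fst u' - fst u)"] u u' up by metis
  next
    case False
    have "u' = (fst u', snd u')" "u = (fst u' + int (nat (fst u - fst u')), snd u' + int (nat (fst u - fst u')))"
      using False ct by (auto simp: ct_def prod_eq_iff)
    then show ?thesis using *[OF th(2,1), of "fst u'" "snd u'" "nat (fst u - fst u')"] u u' up by metis
  qed
qed

section \<open>The decomposition as a cutting of the encoded diagram\<close>

locale skew_shape =
  fixes lam mu :: "nat list" and r :: int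
  assumes lam: "is_partition lam" and mu: "is_partition mu"
    and conn: "edge_connected (skew lam mu)"
begin

abbreviation "D \<equiv> skew lam mu"
abbreviation "cont \<equiv> scontent lam r"

definition pos :: "cell \<Rightarrow> int \<times> int" where "pos x = (cont x, fst x)"

lemma cont_ct: "cont x = ct x + (r - 1 + conjp lam 1)"
  by (simp add: scontent_def ct_def)

lemma cont_up [simp]: "cont (cell_up x) = cont x + 1" and cont_right [simp]: "cont (cell_right x) = cont x + 1"
  by (simp_all add: cont_ct)

lemma cont_eq_iff: "cont x = cont y \<longleftrightarrow> ct x = ct y"
  by (simp add: cont_ct)

lemma inj_pos: "pos x = pos y \<longleftrightarrow> x = y"
  by (auto simp: pos_def scontent_def prod_eq_iff)

lemma pos_in [simp]: "pos x \<in> pos ` A \<longleftrightarrow> x \<in> A"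
  by (auto simp: inj_pos)

lemma fst_pos [simp]: "fst (pos x) = cont x" by (simp add: pos_def)

lemma sc_pos: "sc G (pos x) = pos (if cont x \<in> G then cell_right x else cell_up x)"
  by (simp add: sc_def pos_def) (simp add: cell_up_def cell_right_def)

lemma convex: "convex_cells D" and finite_D: "finite D"
  using convex_skew[OF lam mu] finite_skew by auto

lemma crossing:
  assumes "x \<in> D" "y \<in> D" "cont x \<le> c" "c < cont y"
  shows "\<exists>u\<in>D. cont u = c \<and> (cell_up u \<in> D \<or> cell_right u \<in> D)"
  using content_crossing[OF conn assms(1,2), of "c - (r - 1 + conjp lam 1)"] assms
  by (force simp: cont_ct)

lemma pos_mem: "(c, i) \<in> pos ` D \<longleftrightarrow> (i, i + c - (r - 1 + conjp lam 1)) \<in> D"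
proof
  assume "(c, i) \<in> pos ` D"
  then obtain x where "x \<in> D" "c = cont x" "i = fst x" by (auto simp: pos_def)
  then show "(i, i + c - (r - 1 + conjp lam 1)) \<in> D" by (simp add: scontent_def)
next
  assume *: "(i, i + c - (r - 1 + conjp lam 1)) \<in> D"
  have "pos (i, i + c - (r - 1 + conjp lam 1)) = (c, i)" by (simp add: pos_def scontent_def)
  then show "(c, i) \<in> pos ` D" using * by (metis imageI)
qed

text \<open>Convexity makes each diagonal an interval and forces between two of its cells the
  intermediate cells of the other diagonal (\<open>V1\<close>, \<open>V2\<close>). Connectedness
  supplies one adjacent pair in rows \<open>u\<close> and \<open>v\<close>; comparing the ends of
  the intervals with this pair bounds their differences by one.\<close>

lemma diagonals:
  assumes "c \<in> cont ` D" "c + 1 \<in> cont ` D"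
  shows "\<exists>s t s' t'. (\<forall>i. (c, i) \<in> pos ` D \<longleftrightarrow> s \<le> i \<and> i < t) \<and>
        (\<forall>i. (c + 1, i) \<in> pos ` D \<longleftrightarrow> s' \<le> i \<and> i < t') \<and> s < t \<and> s' < t' \<and>
        (s' = s \<or> s' = s - 1) \<and> (t' = t \<or> t' = t - 1)"
proof -
  let ?K = "r - 1 + conjp lam 1"
  define P where "P i \<longleftrightarrow> (c, i) \<in> pos ` D" for i
  define Q where "Q i \<longleftrightarrow> (c + 1, i) \<in> pos ` D" for i
  have V1: "Q k" if "P i" "P i'" "i \<le> k" "k < i'" for i i' k
    unfolding Q_def pos_mem
    by (rule convex_cellsD[OF convex, of i "i + c - ?K" i' "i' + c - ?K"])
       (use that in \<open>auto simp: P_def pos_mem\<close>)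
  have V2: "P k" if "Q i" "Q i'" "i < k" "k \<le> i'" for i i' k
    unfolding P_def pos_mem
    by (rule convex_cellsD[OF convex, of i "i + (c + 1) - ?K" i' "i' + (c + 1) - ?K"])
       (use that in \<open>auto simp: Q_def pos_mem\<close>)
  have VP: "P k" if "P i" "P i'" "i \<le> k" "k \<le> i'" for i i' k
    unfolding P_def pos_mem
    by (rule convex_cellsD[OF convex, of i "i + c - ?K" i' "i' + c - ?K"])
       (use that in \<open>auto simp: P_def pos_mem\<close>)
  have VQ: "Q k" if "Q i" "Q i'" "i \<le> k" "k \<le> i'" for i i' k
    unfolding Q_def pos_mem
    by (rule convex_cellsD[OF convex, of i "i + (c + 1) - ?K" i' "i' + (c + 1) - ?K"])
       (use that in \<open>auto simp: Q_def pos_mem\<close>)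
  obtain x y where xy: "x \<in> D" "y \<in> D" "cont x = c" "cont y = c + 1" using assms by auto
  obtain w where w: "w \<in> D" "cont w = c" "cell_up w \<in> D \<or> cell_right w \<in> D"
    using crossing[of x y c] xy by auto
  define u where "u = fst w"
  have Pu: "P u" unfolding P_def using w by (intro image_eqI[of _ _ w]) (auto simp: pos_def u_def)
  have "Q (u - 1)" if "cell_up w \<in> D" unfolding Q_def
    using that w by (intro image_eqI[of _ _ "cell_up w"]) (simp_all add: pos_def u_def, simp add: cell_up_def)
  moreover have "Q u" if "cell_right w \<in> D" unfolding Q_def
    using that w by (intro image_eqI[of _ _ "cell_right w"]) (simp_all add: pos_def u_def, simp add: cell_right_def)
  ultimately obtain v where Qv: "Q v" "v = u \<or> v = u - 1" using w by blast
  have finP: "finite {i. P i}"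
    by (rule finite_subset[of _ "fst ` D"]) (auto simp: P_def pos_def finite_D)
  have finQ: "finite {i. Q i}"
    by (rule finite_subset[of _ "fst ` D"]) (auto simp: Q_def pos_def finite_D)
  define s t s' t' where "s = Min {i. P i}" and "t = Max {i. P i}" and "s' = Min {i. Q i}" and "t' = Max {i. Q i}"
  have s: "P s" "\<And>i. P i \<Longrightarrow> s \<le> i" and t: "P t" "\<And>i. P i \<Longrightarrow> i \<le> t"
    using Min_in[OF finP] Max_in[OF finP] Pu Min_le[OF finP] Max_ge[OF finP] by (auto simp: s_def t_def)
  have s': "Q s'" "\<And>i. Q i \<Longrightarrow> s' \<le> i" and t': "Q t'" "\<And>i. Q i \<Longrightarrow> i \<le> t'"
    using Min_in[OF finQ] Max_in[OF finQ] Qv Min_le[OF finQ] Max_ge[OF finQ] by (auto simp: s'_def t'_def)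
  have P_iff: "P i \<longleftrightarrow> s \<le> i \<and> i < t + 1" for i using VP[OF s(1) t(1), of i] s(2)[of i] t(2)[of i] by auto
  have Q_iff: "Q i \<longleftrightarrow> s' \<le> i \<and> i < t' + 1" for i using VQ[OF s'(1) t'(1), of i] s'(2)[of i] t'(2)[of i] by auto
  have u: "s \<le> u" "u \<le> t" "s' \<le> v" "v \<le> t'" using s(2)[OF Pu] t(2)[OF Pu] s'(2)[OF Qv(1)] t'(2)[OF Qv(1)] by auto
  have "s' \<le> s"
  proof (cases "u = s")
    case True
    then show ?thesis using u Qv by auto
  next
    case False
    then show ?thesis using V1[OF s(1) Pu, of s] u s'(2) by simp
  qed
  moreover have "s - 1 \<le> s'"
  proof (rule ccontr)
    assume "\<not> s - 1 \<le> s'"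
    then have "P (s' + 1)" using V2[OF s'(1) Qv(1), of "s' + 1"] u Qv by auto
    then show False using s(2) \<open>\<not> s - 1 \<le> s'\<close> by force
  qed
  moreover have "t - 1 \<le> t'"
  proof (cases "u = t")
    case True
    then show ?thesis using u Qv by auto
  next
    case False
    then show ?thesis using V1[OF Pu t(1), of "t - 1"] u t'(2) by simp
  qed
  moreover have "t' \<le> t"
  proof (rule ccontr)
    assume "\<not> t' \<le> t"
    then have "P t'" using V2[OF Qv(1) t'(1), of t'] u Qv by auto
    then show False using t(2) \<open>\<not> t' \<le> t\<close> by force
  qed
  ultimately have "(\<forall>i. (c, i) \<in> pos ` D \<longleftrightarrow> s \<le> i \<and> i < t + 1) \<and>
        (\<forall>i. (c + 1, i) \<in> pos ` D \<longleftrightarrow> s' \<le> i \<and> i < t' + 1) \<and> s < t + 1 \<and> s' < t' + 1 \<and>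
        (s' = s \<or> s' = s - 1) \<and> (t' + 1 = t + 1 \<or> t' + 1 = t + 1 - 1)"
    using P_iff Q_iff u unfolding P_def Q_def by auto
  then show ?thesis by blast
qed

end

section \<open>Ribbons as chains of the step prescribed by \<open>G\<close>\<close>

locale ribbon_decomposition = skew_shape +
  fixes Th :: "cell set list"
  assumes dec: "outer_ribbon_decomp (skew lam mu) Th"
begin

text \<open>Demanding that \<open>c + 1\<close> occurs leaves out the largest content, whose
  direction is only a convention and from which no step stays in the diagram. It also makes both
  diagonals nonempty, as switching \<open>c\<close> requires.\<close>

definition G :: "int set" where
  "G = {c. c \<in> cont ` D \<and> c + 1 \<in> cont ` D \<and> \<not> content_up lam mu r Th c}"

definition nxt :: "cell \<Rightarrow> cell" where "nxt x = (if cont x \<in> G then cell_right x else cell_up x)"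

lemma cont_nxt [simp]: "cont (nxt x) = cont x + 1" by (simp add: nxt_def)

lemma sc_nxt: "sc G (pos x) = pos (nxt x)" by (simp add: sc_pos nxt_def)

lemma rib: "th \<in> set Th \<Longrightarrow> is_ribbon th"
    "th \<in> set Th \<Longrightarrow> on_left D (bottom_left th) \<or> on_bottom D (bottom_left th)"
    "th \<in> set Th \<Longrightarrow> on_top D (top_right th) \<or> on_right D (top_right th)"
    "th \<in> set Th \<Longrightarrow> x \<in> th \<Longrightarrow> x \<in> D"
    "x \<in> D \<Longrightarrow> \<exists>th\<in>set Th. x \<in> th"
  using dec unfolding outer_ribbon_decomp_def by blast+

lemma ends:
  assumes "th \<in> set Th"
  shows "top_right th \<in> th" "bottom_left th \<in> th"
    "x \<in> th \<Longrightarrow> ct x \<le> ct (top_right th)" "x \<in> th \<Longrightarrow> ct (bottom_left th) \<le> ct x"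
  using ribbon_convex[OF rib(1)[OF assms]] corner_top_right corner_bottom_left
    ct_top_right(1) ct_bottom_left(1) by auto

text \<open>This identifies ribbons with chains: a step never passes from one ribbon into another.
  The perimeter condition on tails is what makes the step leave the diagram at the end of a
  ribbon.\<close>

lemma nxt_cases:
  assumes th: "th \<in> set Th" and x: "x \<in> th"
  shows "nxt x \<in> th \<or> (x = top_right th \<and> nxt x \<notin> D)"
proof -
  have xD: "x \<in> D" using rib(4)[OF th x] .
  then have ne: "D \<noteq> {}" by blast
  note tr = ct_top_right[OF finite_D ne convex]
  note th_conv = ribbon_convex[OF rib(1)[OF th]]
  show ?thesis
  proof (cases "x = top_right D")
    case True
    have "nxt x \<notin> D"
    proof
      assume "nxt x \<in> D"
      then have "ct (nxt x) \<le> ct x" using tr(1) True by simp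
      then show False using cont_nxt[of x] by (simp add: cont_ct)
    qed
    moreover have "ct (top_right th) = ct x"
      using tr(1)[OF rib(4)[OF th ends(1)[OF th]]] ends(3)[OF th x] True by simp
    then have "x = top_right th"
      using ribbon_content_inj[OF rib(1)[OF th] ends(1)[OF th] x] by simp
    ultimately show ?thesis by simp
  next
    case False
    have succ: "cell_up x \<in> th \<or> cell_right x \<in> th" if "x \<noteq> top_right th"
    proof -
      have "ct x < ct (top_right th)"
        using ct_top_right[OF th_conv(2,3,1) x] that by force
      then show ?thesis by (rule ribbon_successor[OF rib(1)[OF th] x ends(1)[OF th]])
    qed
    show ?thesis
    proof (cases "content_up lam mu r Th (cont x)")
      case True
      then obtain t g where g: "t \<in> set Th" "g \<in> t" "cont g = cont x" "goes_up D t g"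
        unfolding content_up_def by blast
      have "goes_up D th x"
        by (rule goes_up_diagonal[OF convex finite_D ne dec g(1) th g(2) x _ g(4)]) (use g(3) cont_eq_iff in blast)
      then have "cell_up x \<in> th \<or> (x = top_right th \<and> cell_up x \<notin> D)"
        using False by (auto simp: goes_up_def on_top_def cell_up_def)
      moreover have "nxt x = cell_up x" using True by (simp add: nxt_def G_def)
      ultimately show ?thesis by simp
    next
      case nup: False
      have "\<not> goes_up D th x" using nup th x unfolding content_up_def by blast
      then have nu: "cell_up x \<notin> th" "x = top_right th \<Longrightarrow> cell_up x \<in> D"
        using False by (auto simp: goes_up_def on_top_def cell_up_def)
      \<comment> \<open>A tail that does not go up is not on the top perimeter, so the cell above it
        has the next content; any other cell has a successor in its ribbon.\<close>
      have "\<exists>v\<in>D. cont v = cont x + 1"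
        using nu(2) succ rib(4)[OF th] cont_up[of x] cont_right[of x] by metis
      then have "cont x \<in> G" using nup xD unfolding G_def by force
      then have "nxt x = cell_right x" by (simp add: nxt_def)
      moreover have "cell_right x \<in> th \<or> (x = top_right th \<and> cell_right x \<notin> D)"
      proof (cases "x = top_right th")
        case True
        then have "on_right D x" using rib(3)[OF th] nu(2) by (auto simp: on_top_def cell_up_def)
        then show ?thesis using True by (simp add: on_right_def cell_right_def)
      next
        case False
        then show ?thesis using succ nu by blast
      qed
      ultimately show ?thesis by simp
    qed
  qed
qed

lemma prev_in_ribbon:
  assumes th: "th \<in> set Th" and x: "x \<in> th" "x \<noteq> bottom_left th"
  shows "\<exists>u\<in>th. nxt u = x"
proof -
  note th_conv = ribbon_convex[OF rib(1)[OF th]]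
  have "ct (bottom_left th) < ct x" using ct_bottom_left[OF th_conv(2,3,1) x(1)] x(2) by force
  then obtain u where u: "u \<in> th" "cell_up u = x \<or> cell_right u = x"
    using ribbon_predecessor[OF rib(1)[OF th] x(1) ends(2)[OF th]] by blast
  have ct: "ct x = ct u + 1" using u(2) by auto
  then have "u \<noteq> top_right th" using ends(3)[OF th x(1)] by auto
  then have "nxt u \<in> th" using nxt_cases[OF th u(1)] by blast
  moreover have "ct (nxt u) = ct x" using ct cont_nxt[of u] by (simp add: cont_ct)
  ultimately show ?thesis using ribbon_content_inj[OF rib(1)[OF th] _ x(1)] u(1) by blast
qed

text \<open>A predecessor in the diagram lies in some ribbon, and the step from it leads to
  \<open>x\<close> inside that ribbon; by disjointness this is \<open>th\<close>, which has no cell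
  before its head.\<close>

lemma head_iff:
  assumes th: "th \<in> set Th" and x: "x \<in> th"
  shows "pd G (pos x) \<in> pos ` D \<longleftrightarrow> x \<noteq> bottom_left th"
proof
  assume "pd G (pos x) \<in> pos ` D"
  then obtain u where u: "u \<in> D" "pd G (pos x) = pos u" by blast
  then have "sc G (pos u) = pos x" by (metis sc_pd)
  then have nu: "nxt u = x" by (simp add: sc_nxt inj_pos)
  obtain t where t: "t \<in> set Th" "u \<in> t" using rib(5)[OF u(1)] by blast
  then have "x \<in> t" using nxt_cases[OF t] nu rib(4)[OF th x] by blast
  then have "t = th" using ribbon_unique[OF dec t(1) th _ x] by blast
  then have "ct (bottom_left th) \<le> ct u" using ends(4)[OF th] t by blast
  moreover have "ct x = ct u + 1" using nu cont_nxt[of u] by (simp add: cont_ct)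
  ultimately show "x \<noteq> bottom_left th" by auto
next
  assume "x \<noteq> bottom_left th"
  then obtain u where u: "u \<in> th" "nxt u = x" using prev_in_ribbon[OF th x] by blast
  then have "pd G (pos x) = pos u" by (metis sc_nxt pd_sc)
  then show "pd G (pos x) \<in> pos ` D" using rib(4)[OF th u(1)] by simp
qed

lemma chain:
  assumes th: "th \<in> set Th" and "int k \<le> ct (top_right th) - ct (bottom_left th)"
  shows "\<exists>u\<in>th. (sc G ^^ k) (pos (bottom_left th)) = pos u \<and> ct u = ct (bottom_left th) + int k"
  using assms(2)
proof (induction k)
  case 0
  then show ?case using ends(2)[OF th] by auto
next
  case (Suc k)
  then obtain u where u: "u \<in> th" "(sc G ^^ k) (pos (bottom_left th)) = pos u" "ct u = ct (bottom_left th) + int k"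
    by auto
  then have "u \<noteq> top_right th" using Suc.prems by auto
  then have "nxt u \<in> th" using nxt_cases[OF th u(1)] by blast
  moreover have "ct (nxt u) = ct u + 1" using cont_nxt[of u] by (simp add: cont_ct)
  ultimately show ?case using u by (intro bexI[of _ "nxt u"]) (simp_all add: sc_nxt)
qed

lemma ribbons_inj:
  assumes "i < length Th" "j < length Th" "x \<in> Th ! i" "x \<in> Th ! j"
  shows "i = j"
  using dec assms unfolding outer_ribbon_decomp_def by (metis disjoint_iff)

lemma fdet_ribbons:
  "fdet (pos ` D) (strip_matrix (pos ` D) G R) =
   det (mat (length Th) (length Th) (\<lambda>(i, j). R (cont (bottom_left (Th ! i))) (cont (top_right (Th ! j)))))"
proof -
  let ?h = "\<lambda>i. pos (bottom_left (Th ! i))" and ?n = "length Th"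
  have inj: "inj_on ?h {0..<?n}"
  proof (rule inj_onI)
    fix i j assume ij: "i \<in> {0..<?n}" "j \<in> {0..<?n}" "?h i = ?h j"
    then have "bottom_left (Th ! i) \<in> Th ! i" "bottom_left (Th ! i) \<in> Th ! j"
      using ends(2)[OF nth_mem, of i] ends(2)[OF nth_mem, of j] by (auto simp: inj_pos)
    then show "i = j" using ribbons_inj ij by auto
  qed
  \<comment> \<open>Distinct ribbons have distinct heads, so a head determines its ribbon and hence
    its tail.\<close>
  define tc where "tc x = pos (top_right (Th ! inv_into {0..<?n} ?h x))" for x
  have tc: "tc (?h i) = pos (top_right (Th ! i))" if "i < ?n" for i
    using inv_into_f_f[OF inj, of i] that by (simp add: tc_def)
  have img: "{x \<in> pos ` D. pd G x \<notin> pos ` D} = ?h ` {0..<?n}"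
  proof (intro Set.set_eqI iffI)
    fix x assume "x \<in> {x \<in> pos ` D. pd G x \<notin> pos ` D}"
    then obtain w where w: "w \<in> D" "x = pos w" "pd G (pos w) \<notin> pos ` D" by blast
    obtain th where th: "th \<in> set Th" "w \<in> th" using rib(5)[OF w(1)] by blast
    then have "w = bottom_left th" using head_iff[OF th] w(3) by blast
    then show "x \<in> ?h ` {0..<?n}" using th(1) w(2) by (auto simp: in_set_conv_nth)
  next
    fix x assume "x \<in> ?h ` {0..<?n}"
    then obtain i where i: "i < ?n" "x = ?h i" by auto
    have th: "Th ! i \<in> set Th" using i by simp
    show "x \<in> {x \<in> pos ` D. pd G x \<notin> pos ` D}"
      using head_iff[OF th ends(2)[OF th]] rib(4)[OF th ends(2)[OF th]] i(2) by simp
  qed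
  have "fdet (pos ` D) (strip_matrix (pos ` D) G R) =
      fdet {x \<in> pos ` D. pd G x \<notin> pos ` D} (\<lambda>x y. R (fst x) (fst (tc y)))"
  proof (rule fdet_strip_matrix)
    show "finite (pos ` D)" using finite_D by simp
    fix x assume "x \<in> pos ` D" "pd G x \<notin> pos ` D"
    then have "x \<in> ?h ` {0..<?n}" using img by blast
    then obtain i where i: "i < ?n" "x = ?h i" by auto
    let ?th = "Th ! i"
    have th: "?th \<in> set Th" using i by simp
    let ?k = "nat (ct (top_right ?th) - ct (bottom_left ?th))"
    have k: "int ?k = ct (top_right ?th) - ct (bottom_left ?th)" using ends(3)[OF th ends(2)[OF th]] by simp
    have nt: "nxt (top_right ?th) \<notin> D"
    proof
      assume "nxt (top_right ?th) \<in> D"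
      then have "nxt (top_right ?th) \<in> ?th" using nxt_cases[OF th ends(1)[OF th]] by blast
      then have "ct (nxt (top_right ?th)) \<le> ct (top_right ?th)" by (rule ends(3)[OF th])
      then show False using cont_nxt[of "top_right ?th"] by (simp add: cont_ct)
    qed
    have "sc G (tc x) \<notin> pos ` D" unfolding i(2) tc[OF i(1)] sc_nxt using nt by simp
    moreover have "tc x = (sc G ^^ ?k) x"
    proof -
      obtain u where u: "u \<in> ?th" "(sc G ^^ ?k) (pos (bottom_left ?th)) = pos u"
        "ct u = ct (bottom_left ?th) + int ?k" using chain[OF th, of ?k] k by auto
      then have "u = top_right ?th" using k ribbon_content_inj[OF rib(1)[OF th] u(1) ends(1)[OF th]] by simp
      then show ?thesis using u(2) tc[OF i(1)] i(2) by simp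
    qed
    moreover have "(sc G ^^ j) x \<in> pos ` D" if "j \<le> ?k" for j
    proof -
      have "int j \<le> ct (top_right ?th) - ct (bottom_left ?th)" using that k by linarith
      from chain[OF th this] show ?thesis using i(2) rib(4)[OF th] by auto
    qed
    ultimately show "sc G (tc x) \<notin> pos ` D \<and> (\<exists>k. tc x = (sc G ^^ k) x \<and> (\<forall>j\<le>k. (sc G ^^ j) x \<in> pos ` D))"
      by blast
  qed
  also have "\<dots> = fdet {0..<?n} (\<lambda>i j. R (fst (?h i)) (fst (tc (?h j))))"
    unfolding img by (rule fdet_reindex) (use inj in \<open>auto simp: bij_betw_def\<close>)
  also have "\<dots> = fdet {0..<?n} (\<lambda>i j. R (cont (bottom_left (Th ! i))) (cont (top_right (Th ! j))))"
    by (rule fdet_cong) (simp add: tc)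
  finally show ?thesis by (simp only: fdet_mat)
qed

end

lemma conjp_mono:
  assumes "is_partition lam" "is_partition mu" "contained mu lam" "1 \<le> j"
  shows "conjp mu j \<le> conjp lam j"
proof (cases "1 \<le> conjp mu j")
  case True
  have "j \<le> part mu (conjp mu j)" using le_conjp_iff[OF assms(2) True assms(4)] by simp
  also have "\<dots> \<le> part lam (conjp mu j)" using assms(3) by (simp add: contained_def)
  finally show ?thesis using le_conjp_iff[OF assms(1) True assms(4)] by simp
next
  case False
  then show ?thesis using conjp_nonneg[of lam j] by linarith
qed

section \<open>The column cutting and the flagged Jacobi-Trudi determinant\<close>

context skew_shape
begin

text \<open>The induced flags depend only on the content of the end cell of the vertical strip.\<close>

definition ext_a :: "(int \<Rightarrow> int) \<Rightarrow> int \<Rightarrow> int" where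
  "ext_a a c = (let m = leftmost_with_content D cont c in a (snd m) - (conjp mu (snd m) + 1) + fst m)"

definition ext_b :: "(int \<Rightarrow> int) \<Rightarrow> int \<Rightarrow> int" where
  "ext_b b c = (let M = rightmost_with_content D cont c in b (snd M) - conjp lam (snd M) + fst M)"

definition segment_entry ::
  "(int \<Rightarrow> int) \<Rightarrow> (int \<Rightarrow> int) \<Rightarrow> (int \<Rightarrow> 'a::comm_ring_1) \<Rightarrow> (int \<Rightarrow> 'a) \<Rightarrow> int \<Rightarrow> int \<Rightarrow> 'a" where
  "segment_entry a b y z d g = esuper (g - d + 1) (vars y (ext_a a g) (ext_b b d))
     (vars z (ext_a a g + g) (ext_b b d + d))"

lemma segment_entry_base: "segment_entry a b y z p (p - 1) = 1"
  and segment_entry_neg: "p > q + 1 \<Longrightarrow> segment_entry a b y z p q = 0"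
  by (simp_all add: segment_entry_def esuper_0 esuper_neg)

lemma D_col: "(i, j) \<in> D \<longleftrightarrow> 1 \<le> j \<and> conjp mu j < i \<and> i \<le> conjp lam j"
proof (cases "1 \<le> j")
  case True
  then show ?thesis using skew_iff_conjp[OF lam mu] by simp
next
  case False
  then show ?thesis using part_nonneg[of mu i] by (auto simp: skew_iff)
qed

text \<open>A cell of equal content further left would have to lie higher, but column tops do not
  rise towards the left. So the top cell is itself the leftmost one, and the correction in the
  induced flag vanishes.\<close>

lemma ext_a_top:
  assumes "(conjp mu j + 1, j) \<in> D"
  shows "ext_a a (cont (conjp mu j + 1, j)) = a j"
proof -
  have left: "j \<le> snd d" if "d \<in> D" "cont d = cont (conjp mu j + 1, j)" for d
  proof (rule ccontr)
    assume *: "\<not> j \<le> snd d"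
    then have "conjp mu j \<le> conjp mu (snd d)" by (intro conjp_antimono) simp
    moreover have "conjp mu (snd d) < fst d" using that(1) D_col[of "fst d" "snd d"] by simp
    ultimately show False using that(2) * by (simp add: scontent_def)
  qed
  have "leftmost_with_content D cont (cont (conjp mu j + 1, j)) = (conjp mu j + 1, j)"
    unfolding leftmost_with_content_def
  proof (rule the_equality)
    fix m assume m: "m \<in> D \<and> cont m = cont (conjp mu j + 1, j) \<and>
      (\<forall>d\<in>D. cont d = cont (conjp mu j + 1, j) \<longrightarrow> snd m \<le> snd d)"
    then have "snd m \<le> j" using assms by force
    then have "snd m = j" using left[of m] m by simp
    then show "m = (conjp mu j + 1, j)" using m by (simp add: scontent_def prod_eq_iff)
  qed (use assms left in simp)
  then show ?thesis by (simp add: ext_a_def)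
qed

text \<open>Dually, a cell of equal content further right would lie lower, while column bottoms do
  not descend towards the right.\<close>

lemma ext_b_bottom:
  assumes "(conjp lam j, j) \<in> D"
  shows "ext_b b (cont (conjp lam j, j)) = b j"
proof -
  have right: "snd d \<le> j" if "d \<in> D" "cont d = cont (conjp lam j, j)" for d
  proof (rule ccontr)
    assume *: "\<not> snd d \<le> j"
    then have "conjp lam (snd d) \<le> conjp lam j" by (intro conjp_antimono) simp
    moreover have "fst d \<le> conjp lam (snd d)" using that(1) D_col[of "fst d" "snd d"] by simp
    ultimately show False using that(2) * by (simp add: scontent_def)
  qed
  have "rightmost_with_content D cont (cont (conjp lam j, j)) = (conjp lam j, j)"
    unfolding rightmost_with_content_def
  proof (rule the_equality)
    fix m assume m: "m \<in> D \<and> cont m = cont (conjp lam j, j) \<and>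
      (\<forall>d\<in>D. cont d = cont (conjp lam j, j) \<longrightarrow> snd d \<le> snd m)"
    then have "j \<le> snd m" using assms by force
    then have "snd m = j" using right[of m] m by simp
    then show "m = (conjp lam j, j)" using m by (simp add: scontent_def prod_eq_iff)
  qed (use assms right in simp)
  then show ?thesis by (simp add: ext_b_def)
qed

lemma fdet_columns:
  assumes sub: "contained mu lam" and n: "part lam 1 \<le> int n"
  shows "flagged_schur n lam mu r a b y z =
    fdet (pos ` D) (strip_matrix (pos ` D) {} (segment_entry a b y z))" (is "_ = fdet _ (strip_matrix _ _ ?E)")
proof -
  let ?J = "{j. 1 \<le> j \<and> j \<le> int n \<and> conjp lam j \<noteq> conjp mu j}" and ?K = "r - 1 + conjp lam 1"
  let ?bot = "\<lambda>j. (conjp lam j, j)" and ?top = "\<lambda>j. (conjp mu j + 1, j)"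
  \<comment> \<open>Content plus row minus \<open>?K\<close> recovers the column of an encoded
    cell.\<close>
  define tc where "tc x = pos (?top (fst x + snd x - ?K))" for x :: "int \<times> int"
  have J: "1 \<le> j" "conjp mu j < conjp lam j" if "j \<in> ?J" for j
    using that conjp_mono[OF lam mu sub, of j] by auto
  have in_J: "j \<in> ?J" if "(i, j) \<in> D" for i j
  proof -
    have "1 \<le> i" "j \<le> part lam i" using that by (simp_all add: skew_iff)
    then have "j \<le> int n" using part_antimono[OF lam, of 1 i] n by simp
    then show ?thesis using that D_col[of i j] by auto
  qed
  have bot: "?bot j \<in> D" and top: "?top j \<in> D" if "j \<in> ?J" for j
    using J[OF that] by (simp_all add: D_col)
  have tc: "tc (pos (?bot j)) = pos (?top j)" for j
    by (simp add: tc_def pos_def scontent_def)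
  have pd: "pd {} (pos (i, j)) = pos (i + 1, j)" and sc: "sc {} (pos (i, j)) = pos (i - 1, j)" for i j
    by (simp_all add: pd_def sc_def pos_def scontent_def)
  have sck: "(sc {} ^^ k) (pos (i, j)) = pos (i - int k, j)" for k i j
    by (induction k) (simp_all add: sc, simp add: algebra_simps)
  have inj: "inj_on (\<lambda>j. pos (?bot j)) ?J"
    by (auto simp: inj_on_def inj_pos)
  have img: "{x \<in> pos ` D. pd {} x \<notin> pos ` D} = (\<lambda>j. pos (?bot j)) ` ?J"
  proof (intro Set.set_eqI iffI)
    fix x assume "x \<in> {x \<in> pos ` D. pd {} x \<notin> pos ` D}"
    then obtain i j where ij: "(i, j) \<in> D" "x = pos (i, j)" "(i + 1, j) \<notin> D"
      using pd by (auto simp: inj_pos)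
    then have "i = conjp lam j" using D_col[of i j] D_col[of "i + 1" j] by auto
    then show "x \<in> (\<lambda>j. pos (?bot j)) ` ?J" using ij in_J[OF ij(1)] by blast
  next
    fix x assume "x \<in> (\<lambda>j. pos (?bot j)) ` ?J"
    then obtain j where j: "j \<in> ?J" "x = pos (?bot j)" by blast
    have "(conjp lam j + 1, j) \<notin> D" by (simp add: D_col)
    then show "x \<in> {x \<in> pos ` D. pd {} x \<notin> pos ` D}"
      using bot[OF j(1)] by (simp add: j(2) pd)
  qed
  have "fdet (pos ` D) (strip_matrix (pos ` D) {} ?E) =
      fdet {x \<in> pos ` D. pd {} x \<notin> pos ` D} (\<lambda>x y. ?E (fst x) (fst (tc y)))"
  proof (rule fdet_strip_matrix)
    show "finite (pos ` D)" using finite_D by simp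
    fix x assume "x \<in> pos ` D" "pd {} x \<notin> pos ` D"
    then have "x \<in> (\<lambda>j. pos (?bot j)) ` ?J" using img by blast
    then obtain j where j: "j \<in> ?J" "x = pos (?bot j)" by blast
    let ?k = "nat (conjp lam j - conjp mu j - 1)"
    have "sc {} (tc x) \<notin> pos ` D" unfolding j(2) tc sc by (simp add: D_col)
    moreover have "tc x = (sc {} ^^ ?k) x"
      unfolding j(2) tc sck using J(2)[OF j(1)] by simp
    moreover have "(sc {} ^^ k) x \<in> pos ` D" if "k \<le> ?k" for k
      unfolding j(2) sck using J[OF j(1)] that by (simp add: D_col)
    ultimately show "sc {} (tc x) \<notin> pos ` D \<and> (\<exists>k. tc x = (sc {} ^^ k) x \<and> (\<forall>j\<le>k. (sc {} ^^ j) x \<in> pos ` D))"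
      by blast
  qed
  also have "\<dots> = fdet ?J (\<lambda>i j. ?E (fst (pos (?bot i))) (fst (tc (pos (?bot j)))))"
    unfolding img
  proof (rule fdet_reindex)
    show "bij_betw (\<lambda>j. pos (?bot j)) ?J ((\<lambda>j. pos (?bot j)) ` ?J)" using inj by (simp add: bij_betw_def)
    show "finite ?J" by (rule finite_subset[of _ "{1..int n}"]) auto
  qed
  also have "\<dots> = fdet ?J (\<lambda>i j. esuper (conjp lam i - i - conjp mu j + j)
        (vars y (a j) (b i)) (vars z (conj_flag_a lam mu r a j) (conj_flag_b lam r b i)))"
  proof (rule fdet_cong)
    fix i j assume ij: "i \<in> ?J" "j \<in> ?J"
    have "cont (?top j) - cont (?bot i) + 1 = conjp lam i - i - conjp mu j + j" by (simp add: scontent_def)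
    then show "?E (fst (pos (?bot i))) (fst (tc (pos (?bot j)))) =
      esuper (conjp lam i - i - conjp mu j + j)
        (vars y (a j) (b i)) (vars z (conj_flag_a lam mu r a j) (conj_flag_b lam r b i))"
      unfolding tc fst_pos segment_entry_def ext_a_top[OF top[OF ij(2)]] ext_b_bottom[OF bot[OF ij(1)]]
        conj_flag_a_def conj_flag_b_def by simp
  qed
  finally show ?thesis using flagged_schur_nonempty_columns[of n lam mu r a b y z] by simp
qed

end

section \<open>The ribbon cutting and the two determinants compared\<close>

context ribbon_decomposition
begin

lemma ribbon_entry_eq:
  assumes ij: "i < length Th" "j < length Th"
  shows "ribbon_entry lam mu r a b Th y z i j =
    ribbon_det (segment_entry a b y z) G (cont (bottom_left (Th ! i))) (cont (top_right (Th ! j)))"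
proof -
  let ?p = "cont (bottom_left (Th ! i))" and ?q = "cont (top_right (Th ! j))" and ?up = "content_up lam mu r Th"
  let ?E = "segment_entry a b y z"
  consider "?p = ?q + 1" | "?p > ?q + 1" | "?p \<le> ?q" by linarith
  then show ?thesis
  proof cases
    case 1
    then show ?thesis using segment_entry_base[of a b y z ?p] by (simp add: ribbon_entry_def ribbon_det_def Let_def)
  next
    case 2
    then show ?thesis using segment_entry_neg[OF 2] by (simp add: ribbon_entry_def ribbon_det_def Let_def)
  next
    case 3
    have "ribbon_entry lam mu r a b Th y z i j =
      flagged_schur (strip_cols ?up ?p ?q) (strip_lam ?up ?p ?q) (strip_mu ?up ?p ?q) ?p
        (induced_a lam mu r a ?up ?p ?q) (induced_b lam mu r b ?up ?p ?q) y z"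
      using 3 by (simp add: ribbon_entry_def Let_def)
    also have "\<dots> = ribbon_det ?E {c. \<not> ?up c} ?p ?q"
      unfolding segment_entry_def
      by (rule flagged_schur_strip[OF 3]) (simp_all add: induced_a_def induced_b_def ext_a_def ext_b_def Let_def)
    also have "\<dots> = ribbon_det ?E G ?p ?q"
    proof -
      \<comment> \<open>By connectedness, every content from \<open>?p\<close> to \<open>?q\<close>
        occurs in the diagram, so in this range \<open>G\<close> consists of all contents that do
        not go up.\<close>
      have ends_D: "bottom_left (Th ! i) \<in> D" "top_right (Th ! j) \<in> D"
        using rib(4)[OF nth_mem[OF ij(1)] ends(2)[OF nth_mem[OF ij(1)]]]
          rib(4)[OF nth_mem[OF ij(2)] ends(1)[OF nth_mem[OF ij(2)]]] .
      have "c \<in> cont ` D \<and> c + 1 \<in> cont ` D" if c: "?p \<le> c" "c < ?q" for c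
      proof -
        obtain u where u: "u \<in> D" "cont u = c" "cell_up u \<in> D \<or> cell_right u \<in> D"
          using crossing[OF ends_D c] by (elim bexE conjE)
        then obtain v where v: "v \<in> D" "cont v = c + 1" by (elim disjE) auto
        show ?thesis using imageI[OF u(1), of cont] imageI[OF v(1), of cont] by (simp only: u(2) v(2))
      qed
      then have "{c. \<not> ?up c} \<inter> {?p..<?q} = G \<inter> {?p..<?q}" unfolding G_def by auto
      then show ?thesis by (simp add: ribbon_det_def)
    qed
    finally show ?thesis .
  qed
qed

lemma flagged_schur_eq_ribbon_det:
  assumes "contained mu lam" "part lam 1 \<le> int n"
  shows "flagged_schur n lam mu r a b y z =
    det (mat (length Th) (length Th) (\<lambda>(i, j). ribbon_entry lam mu r a b Th y z i j))"
proof -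
  let ?E = "segment_entry a b y z" and ?D = "pos ` D"
  have "finite G" by (rule finite_subset[of _ "cont ` D"]) (auto simp: G_def finite_D)
  have "flagged_schur n lam mu r a b y z = fdet ?D (strip_matrix ?D {} ?E)"
    by (rule fdet_columns[OF assms])
  also have "\<dots> = fdet ?D (strip_matrix ?D G (ribbon_det ?E G))"
  proof (rule strip_matrix_toggle_all[symmetric])
    show "\<exists>s t s' t'. (\<forall>i. (c, i) \<in> ?D \<longleftrightarrow> s \<le> i \<and> i < t) \<and>
        (\<forall>i. (c + 1, i) \<in> ?D \<longleftrightarrow> s' \<le> i \<and> i < t') \<and> s < t \<and> s' < t' \<and>
        (s' = s \<or> s' = s - 1) \<and> (t' = t \<or> t' = t - 1)" if "c \<in> G" for c
      by (rule diagonals) (use that in \<open>auto simp: G_def\<close>)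
  qed (use finite_D \<open>finite G\<close> in \<open>simp_all add: segment_entry_base segment_entry_neg\<close>)
  also have "\<dots> = det (mat (length Th) (length Th)
      (\<lambda>(i, j). ribbon_det ?E G (cont (bottom_left (Th ! i))) (cont (top_right (Th ! j)))))"
    by (rule fdet_ribbons)
  also have "\<dots> = det (mat (length Th) (length Th) (\<lambda>(i, j). ribbon_entry lam mu r a b Th y z i j))"
    by (rule arg_cong[where f = det], rule cong_mat) (simp_all add: ribbon_entry_eq)
  finally show ?thesis .
qed

end

theorem theorem5p8:
  fixes lam mu :: "nat list" and r :: int and n :: nat
    and a b :: "int \<Rightarrow> int" and Th :: "cell set list"
    and y z :: "int \<Rightarrow> 'a::comm_ring_1"
  assumes "is_partition lam" and "is_partition mu" and "contained mu lam"
    and "edge_connected (skew lam mu)"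
    and "column_flags n lam mu a b"
    and "outer_ribbon_decomp (skew lam mu) Th"
  shows "flagged_schur n lam mu r a b y z =
         det (mat (length Th) (length Th) (\<lambda>(i, j). ribbon_entry lam mu r a b Th y z i j))"
proof -
  interpret ribbon_decomposition lam mu r Th
    by unfold_locales (use assms in auto)
  show ?thesis
    using assms(3,5) by (intro flagged_schur_eq_ribbon_det) (auto simp: column_flags_def)
qed

end
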